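(* Let $K\subset\mathbb{R}^2_q$ be the regular pentagon with vertices $v_k=\left(\cos\frac{2\pi k}{5},\sin\frac{2\pi k}{5}\right)$, $k=0,\dots,4$, and let $T\subset\mathbb{R}^2_p$ be the regular pentagon with vertices $w_k=\left(\cos\left(-\frac{\pi}{2}+\frac{2\pi k}{5}\right),\sin\left(-\frac{\pi}{2}+\frac{2\pi k}{5}\right)\right)$, $k=0,\dots,4$. Then the Ekeland--Hofer--Zehnder capacity of the Lagrangian product $K\times T\subset\mathbb{R}^2_q\oplus\mathbb{R}^2_p=\mathbb{R}^4$ equals the $T^\circ$-length of any one of the $2$-bounce $T$-billiard trajectories along a diagonal of $K$; i.e., for any two non-adjacent vertices $v_i,v_j$ of $K$, $$ c_{\rm EHZ}(K\times T)=h_T(v_j-v_i)+h_T(v_i-v_j)=2\cos\left(\frac{\pi}{10}\right)\left(1+\cos\left(\frac{\pi}{5}\right)\right). $$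
   Context: $\mathbb{R}^{4}=\mathbb{R}^2_q\oplus\mathbb{R}^2_p$ has coordinates $(q,p)$ and symplectic form $\omega_{\rm std}=\sum_{i=1}^2 dp_i\wedge dq_i$. The pentagons $K,T$ are the convex hulls of their vertices. For a convex body $T\subset\mathbb{R}^n$, the support function is $h_T(u)=\sup\{\langle x,u\rangle : x\in T\}$. The $T^\circ$-length of a closed polygonal curve with vertices $q_1,\dots,q_m$ is $\sum_{i=1}^m h_T(q_{i+1}-q_i)$, where $q_{m+1}=q_1$. The outer normal cone of a convex body $A\subset\mathbb{R}^n$ at $x\in\partial A$ is $N_A(x)=\{u\in\mathbb{R}^n:\langle u,y-x\rangle\le 0\ \forall y\in A\}$. A closed polygonal curve with vertices $q_1,\dots,q_m\in\partial K$ ($m\ge2$) is a closed $T$-billiard trajectory in $K$ (with $m$ bounces) if there are $p_1,\dots,p_m\in\partial T$ such that for all $j$ (indices mod $m$) $q_{j+1}-q_j\in N_T(p_j)$ and $p_{j+1}-p_j\in -N_K(q_{j+1})$. The $2$-bounce trajectory along the diagonal from $v_i$ to $v_j$ is the one with vertices $q_1=v_i$, $q_2=v_j$. Ekeland--Hofer--Zehnder capacity: a convex domain is a bounded convex set with nonempty interior. For a convex domain $\Sigma\subset\mathbb{R}^{2n}$ with smooth boundary, a closed characteristic on $\partial\Sigma$ is a (nonconstant) loop $\gamma$ in $\partial\Sigma$ such that $\dot\gamma(t)$ is a positive multiple of $J\nu(\gamma(t))$ for all $t$, where $\nu$ is the outer normal to $\partial\Sigma$ (equivalently $\nabla H$ for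 a Hamiltonian $H$ having $\Sigma$ as a sublevel set) and $J$ is the standard complex structure, $J^2=-\mathrm{Id}$. Its action is $\mathcal{A}(\gamma)=\int_\gamma\lambda$, where $d\lambda=\omega_{\rm std}$ (e.g. $\lambda=\sum p_i\,dq_i$), with orientation/sign conventions chosen so that the action is positive (i.e. $\mathcal{A}(\gamma)=|\int_\gamma\sum p_i\,dq_i|$). For smooth convex domains $c_{\rm EHZ}(\Sigma)$ is the minimal action among closed characteristics on $\partial\Sigma$. This function is continuous in the Hausdorff topology on smooth convex domains and extends uniquely and continuously to all convex domains; the extension is denoted $c_{\rm EHZ}$. (Equivalently, for non-smooth $\Sigma$, $c_{\rm EHZ}(\Sigma)$ is the minimal action among generalized closed characteristics, i.e. absolutely continuous loops $\gamma$ in $\partial\Sigma$ with $\dot\gamma(t)$ almost everywhere a positive multiple of a vector in $J\partial H(\gamma(t))$, $\partial H$ being the subgradient of a convex $H$, such as the gauge function of $\Sigma$ when the origin is interior to $\Sigma$, having $\Sigma$ as a sublevel set.) *)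

theory Defs
  imports "HOL-Analysis.Analysis"
begin

definition support_function :: "'a::real_inner set \<Rightarrow> 'a \<Rightarrow> real" where
  "support_function T u = (SUP x\<in>T. x \<bullet> u)"

definition normal_cone :: "'a::real_inner set \<Rightarrow> 'a \<Rightarrow> 'a set" where
  "normal_cone A x = {u. \<forall>y\<in>A. u \<bullet> (y - x) \<le> 0}"

text \<open>A closed polygonal curve is the list of its vertices, closed up cyclically.\<close>

definition polygon_length :: "'a::real_inner set \<Rightarrow> 'a list \<Rightarrow> real" where
  "polygon_length T qs =
     (\<Sum>j<length qs. support_function T (qs ! (Suc j mod length qs) - qs ! j))"

definition closed_billiard_trajectory ::
    "'a::euclidean_space set \<Rightarrow> 'a set \<Rightarrow> 'a list \<Rightarrow> bool" where
  "closed_billiard_trajectory T K qs \<longleftrightarrow>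
     2 \<le> length qs \<and> set qs \<subseteq> frontier K \<and>
     (\<exists>ps. length ps = length qs \<and> set ps \<subseteq> frontier T \<and>
        (\<forall>j<length qs. let j' = Suc j mod length qs in
           qs ! j' - qs ! j \<in> normal_cone T (ps ! j) \<and>
           ps ! j' - ps ! j \<in> uminus ` normal_cone K (qs ! j')))"

definition subgradient :: "('a::real_inner \<Rightarrow> real) \<Rightarrow> 'a \<Rightarrow> 'a set" where
  "subgradient H x = {u. \<forall>y. H x + u \<bullet> (y - x) \<le> H y}"

definition absolutely_continuous_path ::
    "real set \<Rightarrow> (real \<Rightarrow> 'a::real_normed_vector) \<Rightarrow> bool" where
  "absolutely_continuous_path I f \<longleftrightarrow>
     (\<forall>\<epsilon>>0. \<exists>\<delta>>0. \<forall>D S. D division_of S \<and> S \<subseteq> I \<and> (\<Sum>k\<in>D. Sup k - Inf k) < \<delta> \<longrightarrow>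
        (\<Sum>k\<in>D. norm (f (Sup k) - f (Inf k))) < \<epsilon>)"

text \<open>
  Phase space is the product of position and momentum space, with points (q, p).
  The sign of \<open>J_std\<close> is that of Hamilton's equations q' = dH/dp, p' = - dH/dq; the opposite
  sign only reverses the orientation of the characteristics.
\<close>

definition J_std :: "'a::real_vector \<times> 'a \<Rightarrow> 'a \<times> 'a" where
  "J_std z = (snd z, - fst z)"

definition action :: "(real \<Rightarrow> 'a::real_inner \<times> 'a) \<Rightarrow> real" where
  "action \<gamma> = \<bar>integral {0..1} (\<lambda>t. snd (\<gamma> t) \<bullet> fst (vector_derivative \<gamma> (at t)))\<bar>"

text \<open>
  The level of a defining function must lie above its minimum: the distance to \<open>\<Sigma>\<close>, for instance,
  also has \<open>\<Sigma>\<close> as a sublevel set, but its subgradients at boundary points contain 0,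
  so constant loops would be admitted. The closure is there because the domain need not
  contain its boundary.
\<close>

definition defining_function :: "'a::euclidean_space set \<Rightarrow> ('a \<Rightarrow> real) \<Rightarrow> bool" where
  "defining_function \<Sigma> H \<longleftrightarrow>
     convex_on UNIV H \<and> (\<exists>c. {x. H x \<le> c} = closure \<Sigma> \<and> (\<exists>x. H x < c))"

definition generalized_closed_characteristic ::
    "('a::euclidean_space \<times> 'a) set \<Rightarrow> (real \<Rightarrow> 'a \<times> 'a) \<Rightarrow> bool" where
  "generalized_closed_characteristic \<Sigma> \<gamma> \<longleftrightarrow>
     absolutely_continuous_path {0..1} \<gamma> \<and>
     pathfinish \<gamma> = pathstart \<gamma> \<and>
     path_image \<gamma> \<subseteq> frontier \<Sigma> \<and>
     (\<exists>H. defining_function \<Sigma> H \<and>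
        (AE t in lebesgue_on {0..1}.
           \<exists>s>0. \<exists>u\<in>subgradient H (\<gamma> t). (\<gamma> has_vector_derivative s *\<^sub>R J_std u) (at t)))"

text \<open>
  The capacity is a minimum, hence \<open>LEAST\<close>: a statement about its value also asserts that
  the minimal action is attained.
\<close>

definition c_EHZ :: "('a::euclidean_space \<times> 'a) set \<Rightarrow> real" where
  "c_EHZ \<Sigma> = (LEAST a. \<exists>\<gamma>. generalized_closed_characteristic \<Sigma> \<gamma> \<and> a = action \<gamma>)"

definition vertex_K :: "nat \<Rightarrow> real^2" where
  "vertex_K k = vector [cos (2 * pi * real k / 5), sin (2 * pi * real k / 5)]"

definition vertex_T :: "nat \<Rightarrow> real^2" where
  "vertex_T k = vector [cos (- pi / 2 + 2 * pi * real k / 5), sin (- pi / 2 + 2 * pi * real k / 5)]"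

definition pentagon_K :: "(real^2) set" where
  "pentagon_K = convex hull (vertex_K ` {0..4})"

definition pentagon_T :: "(real^2) set" where
  "pentagon_T = convex hull (vertex_T ` {0..4})"

end

(*
  Along a generalized closed characteristic (q, p) of K x T one has q' in N_T(p) and -p' in N_K(q),
  so p . q' = h_T(q') >= x . q' for every x in T, and the action is the T-length of q.

  Lower bound. If the sides of K met by q all had outer normals in a common open half plane, some
  linear function of p would be monotone along the loop, making p constant, and then q . p would be
  strictly monotone. So q meets three sides k, k + 2, k + 3 whose normals positively span the plane.
  Replacing p by three constants x, y, z in T between the three times of contact bounds the action
  below by a . (z - x) + b . (x - y) + c . (y - z), with a, b, c the points of contact. The
  differences of x, y, z can be taken normal to the three sides, in either cyclic order, because two
  edges and a diagonal of T form a triangle parallel to these normals, and the reflected triangle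
  fits into T as well. This gives the claimed constant.

  The characteristics are only absolutely continuous, so the fundamental theorem of calculus for the
  gauge integral is needed for such paths: the exceptional null set is put into an open set of small
  measure, where the variation of the path is small.

  Attainment. Traversing the diagonal at a fixed vertex of T, then the altitude of T from this
  vertex at an end point of the diagonal, and both back, is a characteristic with this action.
*)

theory Submission
  imports Defs
begin

section \<open>Absolutely continuous paths\<close>

lemma absolutely_continuous_pathE:
  assumes "absolutely_continuous_path I f" "0 < e"
  obtains d where "0 < d"
    "\<And>D S. \<lbrakk>D division_of S; S \<subseteq> I; (\<Sum>k\<in>D. Sup k - Inf k) < d\<rbrakk>
      \<Longrightarrow> (\<Sum>k\<in>D. norm (f (Sup k) - f (Inf k))) < e"
  using assms unfolding absolutely_continuous_path_def by meson

lemma absolutely_continuous_path_subset: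
  "absolutely_continuous_path I f \<Longrightarrow> J \<subseteq> I \<Longrightarrow> absolutely_continuous_path J f"
  unfolding absolutely_continuous_path_def by (meson order_trans)

text \<open>Turns the smallness condition in the definition of absolute continuity into one on
  Lebesgue measure, so that a division inside an open set of small measure qualifies.\<close>

lemma sum_length_division:
  fixes D :: "real set set"
  assumes "D division_of S"
  shows "(\<Sum>k\<in>D. Sup k - Inf k) = measure lebesgue S"
proof -
  have "Sup k - Inf k = measure lebesgue k" if k: "k \<in> D" for k
  proof -
    obtain a b where "k = cbox a b" "k \<noteq> {}" using division_ofD(3,4)[OF assms k] by auto
    then show ?thesis by (simp add: measure_completion)
  qed
  then show ?thesis using content_division[OF assms] by simp
qed

lemma Lipschitz_imp_absolutely_continuous_path:
  assumes "L-lipschitz_on I f"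
  shows "absolutely_continuous_path I f"
  unfolding absolutely_continuous_path_def
proof (intro allI impI)
  fix e :: real assume e: "e > 0"
  have L: "0 \<le> L" using lipschitz_on_nonneg[OF assms] .
  show "\<exists>\<delta>>0. \<forall>D S. D division_of S \<and> S \<subseteq> I \<and> (\<Sum>k\<in>D. Sup k - Inf k) < \<delta> \<longrightarrow>
        (\<Sum>k\<in>D. norm (f (Sup k) - f (Inf k))) < e"
  \<comment> \<open>\<open>L + 1\<close> instead of \<open>L\<close> keeps the denominator positive
    when \<open>L = 0\<close>.\<close>
  proof (intro exI[of _ "e / (L + 1)"] conjI allI impI)
    fix D S assume D: "D division_of S \<and> S \<subseteq> I \<and> (\<Sum>k\<in>D. Sup k - Inf k) < e / (L + 1)"
    have "norm (f (Sup k) - f (Inf k)) \<le> L * (Sup k - Inf k)" if kD: "k \<in> D" for k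
    proof -
      obtain a b where k: "k = cbox a b" "k \<noteq> {}" "k \<subseteq> S"
        using division_ofD(2,3,4)[OF conjunct1[OF D] kD] by auto
      then have "a \<in> I" "b \<in> I" "a \<le> b" using D by auto
      then show ?thesis using lipschitz_onD[OF assms, of b a] k by (simp add: dist_norm)
    qed
    then have "(\<Sum>k\<in>D. norm (f (Sup k) - f (Inf k))) \<le> L * (\<Sum>k\<in>D. Sup k - Inf k)"
      unfolding sum_distrib_left by (rule sum_mono)
    also have "\<dots> \<le> L * (e / (L + 1))" using D L by (intro mult_left_mono) auto
    also have "\<dots> < e" using e L by (simp add: field_simps)
    finally show "(\<Sum>k\<in>D. norm (f (Sup k) - f (Inf k))) < e" .
  qed (use e L in auto)
qed

lemma absolutely_continuous_path_bounded_linear: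
  assumes f: "absolutely_continuous_path I f" and g: "bounded_linear g"
  shows "absolutely_continuous_path I (\<lambda>t. g (f t))"
  unfolding absolutely_continuous_path_def
proof (intro allI impI)
  fix e :: real assume e: "e > 0"
  obtain B where B: "B > 0" "\<And>x. norm (g x) \<le> norm x * B"
    using bounded_linear.pos_bounded[OF g] by blast
  obtain d where d: "0 < d" "\<And>D S. \<lbrakk>D division_of S; S \<subseteq> I; (\<Sum>k\<in>D. Sup k - Inf k) < d\<rbrakk>
      \<Longrightarrow> (\<Sum>k\<in>D. norm (f (Sup k) - f (Inf k))) < e / B"
    using absolutely_continuous_pathE[OF f, of "e / B"] e B by auto
  show "\<exists>\<delta>>0. \<forall>D S. D division_of S \<and> S \<subseteq> I \<and> (\<Sum>k\<in>D. Sup k - Inf k) < \<delta> \<longrightarrow>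
        (\<Sum>k\<in>D. norm (g (f (Sup k)) - g (f (Inf k)))) < e"
  proof (intro exI[of _ d] conjI allI impI d)
    fix D S assume D: "D division_of S \<and> S \<subseteq> I \<and> (\<Sum>k\<in>D. Sup k - Inf k) < d"
    have "(\<Sum>k\<in>D. norm (g (f (Sup k)) - g (f (Inf k)))) \<le> (\<Sum>k\<in>D. norm (f (Sup k) - f (Inf k)) * B)"
      using B(2) by (intro sum_mono) (simp flip: bounded_linear.linear[OF g, THEN linear_diff])
    also have "\<dots> = (\<Sum>k\<in>D. norm (f (Sup k) - f (Inf k))) * B" by (simp add: sum_distrib_right)
    also have "\<dots> < e" using d(2)[of D S] D B by (simp add: field_simps)
    finally show "(\<Sum>k\<in>D. norm (g (f (Sup k)) - g (f (Inf k)))) < e" .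
  qed
qed

lemma absolutely_continuous_path_imp_continuous_on:
  assumes "absolutely_continuous_path {a..b::real} f"
  shows "continuous_on {a..b} f"
  unfolding continuous_on_iff
proof (intro ballI allI impI)
  fix x e :: real assume x: "x \<in> {a..b}" and e: "e > 0"
  obtain d where d: "0 < d" "\<And>D S. \<lbrakk>D division_of S; S \<subseteq> {a..b}; (\<Sum>k\<in>D. Sup k - Inf k) < d\<rbrakk>
      \<Longrightarrow> (\<Sum>k\<in>D. norm (f (Sup k) - f (Inf k))) < e"
    using absolutely_continuous_pathE[OF assms e] by blast
  \<comment> \<open>A single interval is a division of itself.\<close>
  have *: "norm (f v - f u) < e" if "u \<in> {a..b}" "v \<in> {a..b}" "u \<le> v" "v - u < d" for u v
    using d(2)[of "{cbox u v}" "cbox u v"] that division_of_self[of u v] by auto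
  show "\<exists>d>0. \<forall>x'\<in>{a..b}. dist x' x < d \<longrightarrow> dist (f x') (f x) < e"
  proof (intro exI[of _ d] conjI d ballI impI)
    fix y assume "y \<in> {a..b}" "dist y x < d"
    then show "dist (f y) (f x) < e"
      using *[of x y] *[of y x] x by (cases "x \<le> y") (auto simp: dist_norm norm_minus_commute dist_real_def)
  qed
qed

text \<open>The gauge separates two regimes: at tags outside \<open>E\<close> differentiability
  controls each interval, while at tags in \<open>E\<close> only the total increment matters, and
  absolute continuity makes it small.\<close>

theorem fundamental_theorem_of_calculus_absolutely_continuous:
  fixes f :: "real \<Rightarrow> 'a::banach"
  assumes ac: "absolutely_continuous_path {a..b} f" and "a \<le> b" and E: "negligible E"
    and f': "\<And>t. t \<in> {a..b} - E \<Longrightarrow> (f has_vector_derivative f' t) (at t within {a..b})"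
  shows "(f' has_integral (f b - f a)) {a..b}"
proof -
  \<comment> \<open>Nothing is known about \<open>f'\<close> on \<open>E\<close>; with the value 0,
    tags in \<open>E\<close> contribute nothing to a Riemann sum.\<close>
  let ?g = "\<lambda>t. if t \<in> E then 0 else f' t"
  have "(?g has_integral (f b - f a)) {a..b}"
    unfolding has_integral_real
  proof (intro allI impI)
    fix e :: real assume e: "e > 0"
    obtain \<delta> where \<delta>: "0 < \<delta>" "\<And>D S. \<lbrakk>D division_of S; S \<subseteq> {a..b}; (\<Sum>k\<in>D. Sup k - Inf k) < \<delta>\<rbrakk>
        \<Longrightarrow> (\<Sum>k\<in>D. norm (f (Sup k) - f (Inf k))) < e / 2"
      using absolutely_continuous_pathE[OF ac half_gt_zero[OF e]] by blast
    obtain U where U: "open U" "E \<subseteq> U" "U \<in> lmeasurable" "measure lebesgue U < \<delta>"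
    proof -
      obtain U where U: "open U" "E \<subseteq> U" "U - E \<in> lmeasurable" "emeasure lebesgue (U - E) < ennreal \<delta>"
        using sets_lebesgue_outer_open[of E \<delta>] E \<delta>(1) by (metis negligible_imp_sets)
      have "U = (U - E) \<union> E" using U by blast
      then have "U \<in> lmeasurable" "measure lebesgue U = measure lebesgue (U - E)"
        using U E by (metis fmeasurable.Un negligible_imp_measurable,
          metis measure_Un_null_set fmeasurableD negligible_iff_null_sets)
      moreover have "measure lebesgue (U - E) < \<delta>"
        using U(3,4) \<delta>(1) by (simp add: emeasure_eq_measure2 ennreal_less_iff)
      ultimately show thesis using that U by auto
    qed
    \<comment> \<open>The summand 1 keeps the denominator positive when
      \<open>a = b\<close>.\<close>
    define e' where "e' = e / (2 * (b - a + 1))"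
    have e': "e' > 0" using e \<open>a \<le> b\<close> by (simp add: e'_def)
    have "\<forall>x. \<exists>d>0. x \<in> {a..b} - E \<longrightarrow>
         (\<forall>y\<in>{a..b}. norm (y-x) < d \<longrightarrow> norm (f y - f x - (y-x) *\<^sub>R f' x) \<le> e' * norm (y-x))"
      using f'[unfolded has_vector_derivative_def has_derivative_within_alt] e'
      by (metis zero_less_one)
    then obtain d where d: "\<And>x. 0 < d x"
      "\<And>x y. \<lbrakk>x \<in> {a..b} - E; y \<in> {a..b}; norm (y-x) < d x\<rbrakk>
                        \<Longrightarrow> norm (f y - f x - (y-x) *\<^sub>R f' x) \<le> e' * norm (y-x)"
      by metis
    \<comment> \<open>A fine interval tagged in \<open>E\<close> lies in \<open>U\<close>; any other
      one lies where the derivative estimate at its tag holds.\<close>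
    define \<gamma> where "\<gamma> x = (if x \<in> E then U else ball x (d x))" for x
    show "\<exists>\<gamma>. gauge \<gamma> \<and> (\<forall>\<D>. \<D> tagged_division_of {a..b} \<and> \<gamma> fine \<D> \<longrightarrow>
        norm ((\<Sum>(x, k)\<in>\<D>. measure lborel k *\<^sub>R ?g x) - (f b - f a)) < e)"
    proof (intro exI[of _ \<gamma>] conjI allI impI)
      show "gauge \<gamma>" using U d by (auto simp: gauge_def \<gamma>_def)
      fix p assume p: "p tagged_division_of {a..b} \<and> \<gamma> fine p"
      note pD = tagged_division_ofD[OF conjunct1[OF p]]
      define p1 where "p1 = {(x, K) \<in> p. x \<in> E}"
      define p2 where "p2 = p - p1"
      have fin: "finite p" "p1 \<subseteq> p" "p2 \<subseteq> p" using pD by (auto simp: p1_def p2_def)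
      let ?h = "\<lambda>(x, K). measure lborel K *\<^sub>R ?g x - (f (Sup K) - f (Inf K))"
      have len: "(\<Sum>(x,K)\<in>p. Sup K - Inf K) = b - a"
        using additive_tagged_division_1[where f= "\<lambda>x. x"] p \<open>a \<le> b\<close> by blast
      have "(\<Sum>(x, k)\<in>p. measure lborel k *\<^sub>R ?g x) - (f b - f a) = (\<Sum>z\<in>p. ?h z)"
        using additive_tagged_division_1[OF \<open>a \<le> b\<close>, of p f] p
        by (simp add: sum_subtractf case_prod_unfold)
      also have "\<dots> = (\<Sum>z\<in>p1. ?h z) + (\<Sum>z\<in>p2. ?h z)"
        using sum.subset_diff[OF fin(2,1), of ?h] by (simp add: p2_def add.commute)
      finally have eq: "(\<Sum>(x, k)\<in>p. measure lborel k *\<^sub>R ?g x) - (f b - f a) = (\<Sum>z\<in>p1. ?h z) + (\<Sum>z\<in>p2. ?h z)" .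
      have "norm (\<Sum>z\<in>p1. ?h z) < e / 2"
      proof -
        let ?S = "\<Union>(snd ` p1)"
        have part: "p1 tagged_partial_division_of {a..b}"
          using p fin(2) by (meson tagged_division_of_def tagged_partial_division_subset)
        then have td: "p1 tagged_division_of ?S"
          by (rule tagged_partial_division_of_Union_self)
        have dv: "snd ` p1 division_of ?S"
          using division_of_tagged_division[OF td] .
        have sub: "?S \<subseteq> U \<inter> {a..b}"
          using p pD(3) unfolding p1_def \<gamma>_def fine_def by fastforce
        have "(\<Sum>k\<in>snd ` p1. Sup k - Inf k) = measure lebesgue ?S"
          using sum_length_division[OF dv] .
        also have "\<dots> \<le> measure lebesgue U"
          using sub U(3) lmeasurable_division[OF dv]
          by (intro measure_mono_fmeasurable) auto
        finally have "(\<Sum>k\<in>snd ` p1. norm (f (Sup k) - f (Inf k))) < e / 2"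
          using \<delta>(2)[OF dv] sub U(4) by auto
        moreover have "(\<Sum>(x, k)\<in>p1. norm (f (Sup k) - f (Inf k))) = (\<Sum>k\<in>snd ` p1. norm (f (Sup k) - f (Inf k)))"
        proof -
          \<comment> \<open>Two tags can share only a degenerate interval, on which the increment is
            0, so summing over pairs or over intervals is the same. The case distinction settles an
            empty \<open>cbox u v\<close>, for which \<open>Sup\<close> and \<open>Inf\<close> carry
            no meaning.\<close>
          let ?d = "\<lambda>k. if k = {} then 0 else norm (f (Sup k) - f (Inf k))"
          have "(\<Sum>(x, k)\<in>p1. ?d k) = (\<Sum>k\<in>snd ` p1. ?d k)"
          proof (rule sum.over_tagged_division_lemma[OF td])
            fix u v :: real assume "box u v = {}"
            then show "?d (cbox u v) = 0" by (cases "u = v") auto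
          qed
          moreover have "k \<noteq> {}" if "(x, k) \<in> p1" for x k
            using pD(2) fin(2) that by blast
          then have "(\<Sum>(x, k)\<in>p1. ?d k) = (\<Sum>(x, k)\<in>p1. norm (f (Sup k) - f (Inf k)))"
            and "(\<Sum>k\<in>snd ` p1. ?d k) = (\<Sum>k\<in>snd ` p1. norm (f (Sup k) - f (Inf k)))"
            by (auto intro!: sum.cong)
          ultimately show ?thesis by simp
        qed
        moreover have "norm (\<Sum>z\<in>p1. ?h z) \<le> (\<Sum>(x, k)\<in>p1. norm (f (Sup k) - f (Inf k)))"
          by (rule sum_norm_le) (auto simp: p1_def norm_minus_commute)
        ultimately show ?thesis by simp
      qed
      moreover have "norm (\<Sum>z\<in>p2. ?h z) \<le> e / 2"
      proof -
        have bd: "norm (?h z) \<le> e' * (Sup (snd z) - Inf (snd z)) \<and> 0 \<le> Sup (snd z) - Inf (snd z)"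
          if zp: "z \<in> p" and zE: "fst z \<notin> E" for z
        proof -
          obtain x K where z: "z = (x, K)" by (cases z)
          obtain u v where K: "K = cbox u v" using pD(4) zp z by blast
          have xK: "x \<in> K" and Kab: "K \<subseteq> {a..b}" using pD(2,3) zp z by auto
          then have uv: "u \<le> x" "x \<le> v" "u \<in> K" "v \<in> K" "x \<in> {a..b} - E" using K zE z by auto
          have "K \<subseteq> \<gamma> x" using fineD[OF conjunct2[OF p]] zp z by blast
          then have "K \<subseteq> ball x (d x)" using zE z by (simp add: \<gamma>_def)
          then have n: "norm (u - x) < d x" "norm (v - x) < d x"
            using uv by (auto simp: dist_real_def abs_minus_commute)
          \<comment> \<open>The interval is split at its tag \<open>x\<close>, and the linear
            approximation at \<open>x\<close> is applied to both halves.\<close>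
          have "norm ((v - u) *\<^sub>R f' x - (f v - f u)) = norm (f u - f x - (u - x) *\<^sub>R f' x - (f v - f x - (v - x) *\<^sub>R f' x))"
            by (auto simp: algebra_simps)
          also have "\<dots> \<le> norm (f u - f x - (u - x) *\<^sub>R f' x) + norm (f v - f x - (v - x) *\<^sub>R f' x)"
            by (rule norm_triangle_ineq4)
          also have "\<dots> \<le> e' * norm (u - x) + e' * norm (v - x)"
            using d(2)[OF uv(5) _ n(1)] d(2)[OF uv(5) _ n(2)] uv Kab by (intro add_mono) auto
          also have "\<dots> = e' * (v - u)" using uv by (simp add: algebra_simps)
          finally show ?thesis using uv K zE z by simp
        qed
        have "norm (\<Sum>z\<in>p2. ?h z) \<le> (\<Sum>z\<in>p2. e' * (Sup (snd z) - Inf (snd z)))"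
        proof (rule sum_norm_le)
          fix z assume "z \<in> p2"
          then have "z \<in> p" "fst z \<notin> E" by (auto simp: p1_def p2_def)
          then show "norm (?h z) \<le> e' * (Sup (snd z) - Inf (snd z))" using bd by blast
        qed
        also have "\<dots> = e' * (\<Sum>z\<in>p2. Sup (snd z) - Inf (snd z))"
          by (simp add: sum_distrib_left)
        also have "\<dots> \<le> e' * (\<Sum>z\<in>p. Sup (snd z) - Inf (snd z))"
        proof (intro mult_left_mono sum_mono2 fin)
          fix z assume "z \<in> p - p2"
          then have "z \<in> p" by auto
          then obtain u v where "snd z = cbox u v" "snd z \<noteq> {}"
            using pD(2,4)[of "fst z" "snd z"] by (metis empty_iff prod.collapse)
          then show "0 \<le> Sup (snd z) - Inf (snd z)" by auto
        qed (use e' in auto)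
        also have "\<dots> = e' * (b - a)" using len by (simp add: case_prod_unfold)
        also have "\<dots> \<le> e / 2" using \<open>a \<le> b\<close> e by (simp add: e'_def field_simps)
        finally show ?thesis .
      qed
      ultimately show "norm ((\<Sum>(x, k)\<in>p. measure lborel k *\<^sub>R ?g x) - (f b - f a)) < e"
        unfolding eq using norm_triangle_ineq[of "\<Sum>z\<in>p1. ?h z" "\<Sum>z\<in>p2. ?h z"] by linarith
    qed
  qed
  then show ?thesis
    by (rule has_integral_spike[OF E, rotated]) auto
qed

lemma fundamental_theorem_of_calculus_absolutely_continuous_subinterval:
  fixes f :: "real \<Rightarrow> 'a::banach"
  assumes ac: "absolutely_continuous_path {a..b} f" and E: "negligible E"
    and f': "\<And>t. t \<in> {a..b} - E \<Longrightarrow> (f has_vector_derivative f' t) (at t within {a..b})"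
    and uv: "a \<le> u" "u \<le> v" "v \<le> b"
  shows "(f' has_integral (f v - f u)) {u..v}"
proof (rule fundamental_theorem_of_calculus_absolutely_continuous[OF _ uv(2) E])
  have sub: "{u..v} \<subseteq> {a..b}" using uv by auto
  show "absolutely_continuous_path {u..v} f"
    using absolutely_continuous_path_subset[OF ac sub] .
  show "(f has_vector_derivative f' t) (at t within {u..v})" if "t \<in> {u..v} - E" for t
    using has_vector_derivative_within_subset[OF f' sub] that sub by blast
qed

text \<open>Integrals of \<open>f'\<close> are increments of \<open>f\<close>, so on an interval
  shorter than some \<open>d\<close> absolute continuity bounds their variation by 1. Finitely many
  such intervals cover the domain.\<close>

lemma absolutely_continuous_path_deriv_absolutely_integrable:
  fixes f :: "real \<Rightarrow> 'a::euclidean_space"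
  assumes ac: "absolutely_continuous_path {a..b} f" and E: "negligible E"
    and f': "\<And>t. t \<in> {a..b} - E \<Longrightarrow> (f has_vector_derivative f' t) (at t within {a..b})"
  shows "f' absolutely_integrable_on {a..b}"
proof -
  have FTC: "(f' has_integral (f v - f u)) {u..v}" if "{u..v} \<subseteq> {a..b}" "u \<le> v" for u v
    using fundamental_theorem_of_calculus_absolutely_continuous_subinterval[OF ac E f'] that by auto
  obtain d where d: "0 < d" "\<And>D S. \<lbrakk>D division_of S; S \<subseteq> {a..b}; (\<Sum>k\<in>D. Sup k - Inf k) < d\<rbrakk>
      \<Longrightarrow> (\<Sum>k\<in>D. norm (f (Sup k) - f (Inf k))) < 1"
    using absolutely_continuous_pathE[OF ac zero_less_one] by blast
  have short: "f' absolutely_integrable_on {u..v}" if uv: "{u..v} \<subseteq> {a..b}" "v - u < d" for u v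
  proof (cases "u \<le> v")
    case True
    have "f' absolutely_integrable_on cbox u v"
    proof (rule bounded_variation_absolutely_integrable_interval[where B = 1])
      show "f' integrable_on cbox u v" using FTC[OF uv(1) True] by auto
      fix D assume D: "D division_of cbox u v"
      have "(\<Sum>k\<in>D. norm (integral k f')) = (\<Sum>k\<in>D. norm (f (Sup k) - f (Inf k)))"
      proof (rule sum.cong[OF refl])
        fix k assume k: "k \<in> D"
        obtain x y where xy: "k = cbox x y" "k \<noteq> {}" "k \<subseteq> cbox u v"
          using division_ofD(2,3,4)[OF D k] by auto
        then show "norm (integral k f') = norm (f (Sup k) - f (Inf k))"
          using integral_unique[OF FTC[of x y]] uv by auto
      qed
      also have "\<dots> < 1"
        using d(2)[OF D] uv True sum_length_division[OF D] by auto
      finally show "(\<Sum>k\<in>D. norm (integral k f')) \<le> 1" by simp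
    qed
    then show ?thesis by simp
  qed auto
  \<comment> \<open>Steps of \<open>d / 2\<close> keep each new piece strictly shorter than
    \<open>d\<close>; \<open>min b\<close> stops the growth at \<open>b\<close>.\<close>
  have "f' absolutely_integrable_on {a..min b (a + real n * (d / 2))}" for n
  proof (induction n)
    case 0
    then show ?case using short[of a "min b a"] d(1) by auto
  next
    case (Suc n)
    let ?u = "min b (a + real n * (d / 2))" and ?v = "min b (a + real (Suc n) * (d / 2))"
    show ?case
    proof (cases "a \<le> b")
      case True
      have le: "a \<le> ?u" "?u \<le> ?v" "?v - ?u < d" "{?u..?v} \<subseteq> {a..b}"
        using d(1) True by (auto simp: min_def algebra_simps divide_simps)
      have "f' absolutely_integrable_on {a..?u} \<union> {?u..?v}"
        using Suc short[OF le(4,3)] by (intro set_integrable_Un) auto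
      moreover have "{a..?u} \<union> {?u..?v} = {a..?v}" using le(1,2) by auto
      ultimately show ?thesis by simp
    qed auto
  qed
  moreover obtain n :: nat where "(b - a) / (d / 2) \<le> real n" using real_arch_simple by blast
  then have "min b (a + real n * (d / 2)) = b" using d(1) by (simp add: field_simps min_def)
  ultimately show ?thesis by metis
qed

text \<open>Increments are integrals of the derivative, so a null set of times does not matter. For
  merely continuous paths this fails: minus the Cantor function decreases although its derivative is
  0 almost everywhere.\<close>

lemma absolutely_continuous_path_mono:
  fixes f :: "real \<Rightarrow> real"
  assumes ac: "absolutely_continuous_path {a..b} f" and E: "negligible E"
    and f': "\<And>t. t \<in> {a..b} - E \<Longrightarrow> (f has_vector_derivative f' t) (at t within {a..b})"
    and nonneg: "\<And>t. t \<in> {a..b} - E \<Longrightarrow> 0 \<le> f' t"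
  shows "mono_on {a..b} f"
proof (rule mono_onI)
  fix u v assume uv: "u \<in> {a..b}" "v \<in> {a..b}" "u \<le> v"
  have "((\<lambda>t. if t \<in> E then 0 else f' t) has_integral (f v - f u)) {u..v}"
  proof (rule has_integral_spike[OF E])
    show "(f' has_integral (f v - f u)) {u..v}"
      using fundamental_theorem_of_calculus_absolutely_continuous_subinterval[OF ac E f'] uv by auto
  qed auto
  then have "0 \<le> f v - f u" by (rule has_integral_nonneg) (use uv nonneg in auto)
  then show "f u \<le> f v" by simp
qed

text \<open>A closed absolutely continuous path that is monotone is constant.\<close>

lemma absolutely_continuous_path_closed_deriv_0:
  fixes f :: "real \<Rightarrow> real"
  assumes ac: "absolutely_continuous_path {a..b} f" and E: "negligible E"
    and f': "\<And>t. t \<in> {a..b} - E \<Longrightarrow> (f has_vector_derivative f' t) (at t within {a..b})"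
    and nonneg: "\<And>t. t \<in> {a..b} - E \<Longrightarrow> 0 \<le> f' t"
    and closed: "f a = f b" and t: "t \<in> {a..b} - E" and "a < b"
  shows "f' t = 0"
proof -
  have const: "f s = f a" if s: "s \<in> {a..b}" for s
  proof -
    note mono = mono_onD[OF absolutely_continuous_path_mono[OF ac E f' nonneg]]
    have "f a \<le> f s" "f s \<le> f b" using mono[of a s] mono[of s b] s by auto
    then show ?thesis using closed by simp
  qed
  have "(f has_vector_derivative 0) (at t within {a..b})"
    by (rule has_vector_derivative_transform[OF _ _ has_vector_derivative_const]) (use t const in blast)+
  with f'[OF t] show ?thesis
    using vector_derivative_unique_within_closed_interval[OF \<open>a < b\<close>, of t f] t
    by (metis DiffD1 box_real(2))
qed

section \<open>Normal cones and regular pentagons\<close>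

definition polar :: "real \<Rightarrow> real^2" where
  "polar t = vector [cos t, sin t]"

lemma polar_nth [simp]: "polar t $ 1 = cos t" "polar t $ 2 = sin t"
  by (simp_all add: polar_def)

lemma inner_polar: "polar s \<bullet> polar t = cos (s - t)"
  by (simp add: inner_vec_def sum_2 cos_diff)

text \<open>A chord of the unit circle is perpendicular to the bisector of the angle it spans. The
  directions of edges and diagonals of the pentagons are read off from this.\<close>

lemma polar_diff: "polar s - polar t = (2 * sin ((s - t) / 2)) *\<^sub>R polar ((s + t) / 2 + pi / 2)"
proof -
  have "sin ((t - s) / 2) = - sin ((s - t) / 2)"
    by (metis minus_diff_eq minus_divide_left sin_minus)
  then show ?thesis
    by (simp add: vec_eq_iff forall_2 cos_diff_cos sin_diff_sin cos_add sin_add)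
qed

lemma polar_add_pi: "polar (t + pi) = - polar t"
  by (simp add: vec_eq_iff forall_2)

lemma polar_periodic: "polar (t + 2 * pi) = polar t"
  by (simp add: vec_eq_iff forall_2)

lemma exists_polar: "\<exists>r\<ge>0. \<exists>t\<ge>0. t < 2 * pi \<and> x = r *\<^sub>R polar (\<theta> + t)"
proof (cases "x = 0")
  case True
  then show ?thesis by (intro exI[of _ 0]) auto
next
  case False
  define r where "r = norm x"
  have r: "r > 0" using False by (simp add: r_def)
  \<comment> \<open>The coordinates of \<open>x / r\<close> in the orthonormal frame rotated by
    \<open>\<theta>\<close>.\<close>
  define a b where "a = (x \<bullet> polar \<theta>) / r" and "b = (x \<bullet> polar (\<theta> + pi / 2)) / r"
  have sc: "(cos \<theta>)\<^sup>2 = 1 - (sin \<theta>)\<^sup>2" by (simp add: cos_squared_eq)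
  have "r\<^sup>2 = (x $ 1)\<^sup>2 + (x $ 2)\<^sup>2"
    unfolding r_def power2_norm_eq_inner inner_vec_def sum_2 by (simp add: power2_eq_square)
  moreover have "(x \<bullet> polar \<theta>)\<^sup>2 + (x \<bullet> polar (\<theta> + pi / 2))\<^sup>2 = (x $ 1)\<^sup>2 + (x $ 2)\<^sup>2"
    using sc by (simp add: inner_vec_def sum_2 cos_add sin_add) algebra
  ultimately have "a\<^sup>2 + b\<^sup>2 = 1"
    using r by (simp add: a_def b_def power_divide add_divide_distrib[symmetric] del: sum_power2_eq_zero_iff)
      (metis divide_self_if power_not_zero less_irrefl)
  then obtain t where t: "0 \<le> t" "t < 2 * pi" "a = cos t" "b = sin t"
    using sincos_total_2pi by metis
  have ra: "r * a = x $ 1 * cos \<theta> + x $ 2 * sin \<theta>" "r * b = x $ 2 * cos \<theta> - x $ 1 * sin \<theta>"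
    using r by (simp_all add: a_def b_def inner_vec_def sum_2 cos_add sin_add)
  have "x $ 1 = (r * a) * cos \<theta> - (r * b) * sin \<theta>" "x $ 2 = (r * a) * sin \<theta> + (r * b) * cos \<theta>"
    unfolding ra using sc by algebra+
  then have "x = r *\<^sub>R polar (\<theta> + t)"
    by (simp add: vec_eq_iff forall_2 cos_add sin_add t algebra_simps)
  then show ?thesis using t r by (intro exI[of _ r] exI[of _ t] conjI) auto
qed

text \<open>Coordinates of a direction \<open>c\<close> with respect to \<open>a\<close> and
  \<open>b\<close>. The coefficients are nonnegative when \<open>c\<close> lies between
  \<open>a\<close> and \<open>b\<close> and \<open>b - a\<close> is at most
  \<open>pi\<close>.\<close>

lemma polar_interpolate:
  "sin (b - a) *\<^sub>R polar c = sin (b - c) *\<^sub>R polar a + sin (c - a) *\<^sub>R polar b"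
  by (simp add: vec_eq_iff forall_2 sin_diff algebra_simps)

section \<open>Vertices and side normals of a regular pentagon\<close>

definition pentagon_vertex :: "real \<Rightarrow> nat \<Rightarrow> real^2" where
  "pentagon_vertex \<theta> k = polar (\<theta> + 2 * pi * real k / 5)"

text \<open>\<open>pentagon_normal \<theta> k\<close> is normal to the side from vertex k to vertex k + 1.\<close>

definition pentagon_normal :: "real \<Rightarrow> nat \<Rightarrow> real^2" where
  "pentagon_normal \<theta> k = polar (\<theta> + pi / 5 + 2 * pi * real k / 5)"

text \<open>Carries the periodicity of the vertices over to the normals.\<close>

lemma pentagon_normal_eq_vertex: "pentagon_normal \<theta> k = pentagon_vertex (\<theta> + pi / 5) k"
  by (simp add: pentagon_normal_def pentagon_vertex_def)

lemma sin_2pi5_pos: "sin (2 * pi / 5) > 0"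
  by (intro sin_gt_zero) auto

text \<open>The cones over the five sides cover the plane, and the angle of \<open>x\<close> selects
  one. For \<open>k = 4\<close> the second vertex has index 5, which is vertex 0 again.\<close>

lemma pentagon_fan:
  obtains k a b where "k \<le> 4" "0 \<le> a" "0 \<le> b" "x = a *\<^sub>R pentagon_vertex \<theta> k + b *\<^sub>R pentagon_vertex \<theta> (Suc k)"
proof -
  obtain r t where r: "r \<ge> 0" and t: "0 \<le> t" "t < 2 * pi" and x: "x = r *\<^sub>R polar (\<theta> + t)"
    using exists_polar by metis
  \<comment> \<open>The number of the sector of width \<open>2 * pi / 5\<close> that contains the
    angle \<open>t\<close>.\<close>
  define k where "k = nat \<lfloor>t * 5 / (2 * pi)\<rfloor>"
  have "real k = of_int \<lfloor>t * 5 / (2 * pi)\<rfloor>" using t by (simp add: k_def)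
  then have "real k \<le> t * 5 / (2 * pi)" "t * 5 / (2 * pi) < real k + 1"
    using floor_correct[of "t * 5 / (2 * pi)"] by auto
  then have k: "2 * pi * real k / 5 \<le> t" "t \<le> 2 * pi * real (Suc k) / 5"
    by (simp_all add: field_simps)
  have "2 * pi * real k / 5 < 2 * pi" using k t by linarith
  then have k4: "k \<le> 4" by (simp add: field_simps)
  define a b where "a = r * sin (2 * pi * real (Suc k) / 5 - t) / sin (2 * pi / 5)"
    and "b = r * sin (t - 2 * pi * real k / 5) / sin (2 * pi / 5)"
  have d: "2 * pi * real (Suc k) / 5 - 2 * pi * real k / 5 = 2 * pi / 5" by (simp add: field_simps)
  have le: "2 * pi / 5 \<le> pi" by simp
  have "0 \<le> a" "0 \<le> b" unfolding a_def b_def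
    using k d le r sin_2pi5_pos by (auto intro!: divide_nonneg_pos mult_nonneg_nonneg sin_ge_zero simp del: of_nat_Suc)
  moreover have "x = a *\<^sub>R pentagon_vertex \<theta> k + b *\<^sub>R pentagon_vertex \<theta> (Suc k)"
  proof -
    have "sin (2 * pi / 5) *\<^sub>R polar (\<theta> + t) =
        sin (2 * pi * real (Suc k) / 5 - t) *\<^sub>R pentagon_vertex \<theta> k + sin (t - 2 * pi * real k / 5) *\<^sub>R pentagon_vertex \<theta> (Suc k)"
      using polar_interpolate[of "\<theta> + 2 * pi * real (Suc k) / 5" "\<theta> + 2 * pi * real k / 5" "\<theta> + t"]
      unfolding add_diff_cancel_left d pentagon_vertex_def .
    then have "(r / sin (2 * pi / 5)) *\<^sub>R (sin (2 * pi / 5) *\<^sub>R polar (\<theta> + t)) = a *\<^sub>R pentagon_vertex \<theta> k + b *\<^sub>R pentagon_vertex \<theta> (Suc k)"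
      by (simp add: a_def b_def scaleR_add_right)
    then show ?thesis using sin_2pi5_pos x by simp
  qed
  ultimately show thesis using that k4 by blast
qed

text \<open>Cosine decreases on \<open>[0, pi]\<close> and is symmetric about
  \<open>pi\<close>.\<close>

lemma cos_le_cos:
  assumes "0 \<le> a" "a \<le> \<bar>x\<bar>" "\<bar>x\<bar> \<le> 2 * pi - a"
  shows "cos x \<le> cos a"
proof (cases "\<bar>x\<bar> \<le> pi")
  case True
  then show ?thesis using cos_monotone_0_pi_le[of a "\<bar>x\<bar>"] assms by simp
next
  case False
  have "cos x = cos (2 * pi - \<bar>x\<bar>)" by (simp add: cos_diff)
  also have "\<dots> \<le> cos a" using cos_monotone_0_pi_le[of a "2 * pi - \<bar>x\<bar>"] assms False by simp
  finally show ?thesis .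
qed

section \<open>The half-plane description of a regular pentagon\<close>

definition pentagon :: "real \<Rightarrow> (real^2) set" where
  "pentagon \<theta> = convex hull (pentagon_vertex \<theta> ` {0..4})"

lemma convex_pentagon: "convex (pentagon \<theta>)"
  by (simp add: pentagon_def)

lemma convex_subconvex_combination:
  fixes C :: "'a::real_vector set"
  assumes C: "convex C" "0 \<in> C" "x \<in> C" "y \<in> C" and ab: "0 \<le> a" "0 \<le> b" "a + b \<le> 1"
  shows "a *\<^sub>R x + b *\<^sub>R y \<in> C"
proof (cases "a + b = 0")
  case True
  then have "a = 0" "b = 0" using ab by auto
  then show ?thesis using C by simp
next
  case False
  let ?z = "(a / (a + b)) *\<^sub>R x + (b / (a + b)) *\<^sub>R y"
  have "?z \<in> C" using C ab False
    by (intro convexD[OF C(1)]) (simp_all flip: add_divide_distrib)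
  then have "(1 - (a + b)) *\<^sub>R 0 + (a + b) *\<^sub>R ?z \<in> C"
    by (rule convexD[OF C(1,2)]) (use ab in auto)
  then show ?thesis using False by (simp add: scaleR_add_right)
qed

lemma pentagon_vertex_add_5: "pentagon_vertex \<theta> (k + 5) = pentagon_vertex \<theta> k"
proof -
  have "\<theta> + 2 * pi * real (k + 5) / 5 = (\<theta> + 2 * pi * real k / 5) + 2 * pi" by (simp add: field_simps)
  then show ?thesis by (simp only: pentagon_vertex_def polar_periodic)
qed

lemma pentagon_vertex_mod_5: "pentagon_vertex \<theta> (k mod 5) = pentagon_vertex \<theta> k"
proof -
  have "pentagon_vertex \<theta> (j + 5 * n) = pentagon_vertex \<theta> j" for j n
  proof (induction n)
    case (Suc n)
    have "j + 5 * Suc n = (j + 5 * n) + 5" by simp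
    then show ?case using Suc by (simp only: pentagon_vertex_add_5)
  qed simp
  then show ?thesis using mod_mult_div_eq[of k 5] by metis
qed

lemma pentagon_normal_add_5: "pentagon_normal \<theta> (k + 5) = pentagon_normal \<theta> k"
  and pentagon_normal_mod_5: "pentagon_normal \<theta> (k mod 5) = pentagon_normal \<theta> k"
  by (simp_all only: pentagon_normal_eq_vertex pentagon_vertex_add_5 pentagon_vertex_mod_5)

lemma pentagon_vertex_in_pentagon: "pentagon_vertex \<theta> k \<in> pentagon \<theta>"
proof -
  have "k mod 5 \<in> {0..4}" by auto
  then have "pentagon_vertex \<theta> (k mod 5) \<in> pentagon \<theta>"
    unfolding pentagon_def by (intro hull_inc imageI)
  then show ?thesis by (simp only: pentagon_vertex_mod_5)
qed

text \<open>The angle between a vertex and a side normal is an odd multiple of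
  \<open>pi / 5\<close>, so its cosine is at most \<open>cos (pi / 5)\<close>, the inradius.
  Reducing the indices modulo 5 first bounds this multiple by 9.\<close>

lemma inner_pentagon_vertex_le: "pentagon_vertex \<theta> j \<bullet> pentagon_normal \<theta> k \<le> cos (pi / 5)"
proof -
  define j' k' where "j' = int (j mod 5)" and "k' = int (k mod 5)"
  have "pentagon_vertex \<theta> j \<bullet> pentagon_normal \<theta> k = pentagon_vertex \<theta> (j mod 5) \<bullet> pentagon_normal \<theta> (k mod 5)"
    by (simp only: pentagon_vertex_mod_5 pentagon_normal_mod_5)
  also have "\<dots> = cos (of_int (2 * (j' - k') - 1) * pi / 5)"
    unfolding pentagon_vertex_def pentagon_normal_def inner_polar by (rule arg_cong[where f = cos]) (simp add: j'_def k'_def field_simps)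
  also have "\<dots> \<le> cos (pi / 5)"
  proof (rule cos_le_cos)
    let ?m = "2 * (j' - k') - 1"
    have "0 \<le> j'" "j' \<le> 4" "0 \<le> k'" "k' \<le> 4" by (auto simp: j'_def k'_def)
    then have "1 \<le> \<bar>?m\<bar>" "\<bar>?m\<bar> \<le> 9" by presburger+
    then have "1 \<le> real_of_int \<bar>?m\<bar>" "real_of_int \<bar>?m\<bar> \<le> 9" by linarith+
    then have "1 * pi \<le> real_of_int \<bar>?m\<bar> * pi" "real_of_int \<bar>?m\<bar> * pi \<le> 9 * pi"
      by (intro mult_right_mono; simp)+
    then show "pi / 5 \<le> \<bar>of_int ?m * pi / 5\<bar>" "\<bar>of_int ?m * pi / 5\<bar> \<le> 2 * pi - pi / 5"
      by (simp_all add: abs_mult)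
  qed simp
  finally show ?thesis .
qed

lemma cos_pi5_pos: "cos (pi / 5) > 0"
  by (intro cos_gt_zero) auto

text \<open>The two neighbours of a vertex add up to \<open>2 * cos (2 * pi / 5)\<close> times that
  vertex. Summed over the cycle, twice the total equals this factor times the total, and the factor
  is less than 2.\<close>

lemma sum_pentagon_vertex: "(\<Sum>k\<le>4. pentagon_vertex \<theta> k) = 0"
proof -
  let ?S = "\<Sum>k\<le>4. pentagon_vertex \<theta> k"
  have "pentagon_vertex \<theta> (k + 1) + pentagon_vertex \<theta> (k + 4) = (2 * cos (2 * pi / 5)) *\<^sub>R pentagon_vertex \<theta> k" for k
  proof -
    have "\<theta> + 2 * pi * real (k + 1) / 5 = (\<theta> + 2 * pi * real k / 5) + 2 * pi / 5"
      "\<theta> + 2 * pi * real (k + 4) / 5 = ((\<theta> + 2 * pi * real k / 5) - 2 * pi / 5) + 2 * pi"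
      by (simp_all add: field_simps)
    then show ?thesis
      by (simp only: pentagon_vertex_def polar_periodic) (simp add: vec_eq_iff forall_2 cos_add sin_add cos_diff sin_diff)
  qed
  then have "(\<Sum>k\<le>4. pentagon_vertex \<theta> (k + 1)) + (\<Sum>k\<le>4. pentagon_vertex \<theta> (k + 4)) = (2 * cos (2 * pi / 5)) *\<^sub>R ?S"
    by (simp only: scaleR_sum_right flip: sum.distrib)
  moreover have "(\<Sum>k\<le>4. pentagon_vertex \<theta> (k + 1)) = ?S" "(\<Sum>k\<le>4. pentagon_vertex \<theta> (k + 4)) = ?S"
    using pentagon_vertex_add_5[of \<theta> 0] pentagon_vertex_add_5[of \<theta> 1] pentagon_vertex_add_5[of \<theta> 2] pentagon_vertex_add_5[of \<theta> 3]
    by (simp_all add: numeral_eq_Suc)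
  ultimately have "?S + ?S = (2 * cos (2 * pi / 5)) *\<^sub>R ?S" by simp
  then have "(2 - 2 * cos (2 * pi / 5)) *\<^sub>R ?S = 0"
    by (simp only: scaleR_diff_left scaleR_2 right_minus_eq)
  moreover have "cos (2 * pi / 5) < 1"
    using cos_monotone_0_pi[of 0 "2 * pi / 5"] by simp
  ultimately show ?thesis by simp
qed

text \<open>For the converse, \<open>x\<close> lies in the cone over some side. The inequality for
  that side bounds the sum of the two cone coordinates by 1, so \<open>x\<close> is a convex
  combination of two vertices and the centre.\<close>

theorem mem_pentagon_iff: "x \<in> pentagon \<theta> \<longleftrightarrow> (\<forall>k\<le>4. x \<bullet> pentagon_normal \<theta> k \<le> cos (pi / 5))"
proof
  assume "x \<in> pentagon \<theta>"
  moreover have "pentagon \<theta> \<subseteq> {x. x \<bullet> pentagon_normal \<theta> k \<le> cos (pi / 5)}" for k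
    unfolding pentagon_def
    using inner_pentagon_vertex_le[of \<theta> _ k] convex_halfspace_le[of "pentagon_normal \<theta> k" "cos (pi / 5)"]
    by (intro hull_minimal) (auto simp: inner_commute)
  ultimately show "\<forall>k\<le>4. x \<bullet> pentagon_normal \<theta> k \<le> cos (pi / 5)" by blast
next
  assume *: "\<forall>k\<le>4. x \<bullet> pentagon_normal \<theta> k \<le> cos (pi / 5)"
  obtain k a b where k: "k \<le> 4" "0 \<le> a" "0 \<le> b" "x = a *\<^sub>R pentagon_vertex \<theta> k + b *\<^sub>R pentagon_vertex \<theta> (Suc k)"
    using pentagon_fan by blast
  have "\<theta> + 2 * pi * real k / 5 - (\<theta> + pi / 5 + 2 * pi * real k / 5) = - (pi / 5)"
       "\<theta> + 2 * pi * real (Suc k) / 5 - (\<theta> + pi / 5 + 2 * pi * real k / 5) = pi / 5"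
    by (simp_all add: field_simps)
  then have "x \<bullet> pentagon_normal \<theta> k = (a + b) * cos (pi / 5)"
    unfolding k inner_add_left inner_scaleR_left pentagon_vertex_def pentagon_normal_def inner_polar by (simp only: cos_minus) (simp add: algebra_simps)
  then have ab: "a + b \<le> 1" using * k(1) cos_pi5_pos by (auto simp: mult_le_cancel_right1)
  have "0 \<in> pentagon \<theta>"
  proof -
    have "(\<Sum>k\<in>{..4::nat}. (1/5) *\<^sub>R pentagon_vertex \<theta> k) \<in> pentagon \<theta>"
      using pentagon_vertex_in_pentagon by (intro convex_sum) (auto simp: pentagon_def)
    then show ?thesis by (simp add: sum_pentagon_vertex flip: scaleR_sum_right)
  qed
  then have "a *\<^sub>R pentagon_vertex \<theta> k + b *\<^sub>R pentagon_vertex \<theta> (Suc k) \<in> pentagon \<theta>"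
    using convex_subconvex_combination[OF convex_pentagon _ pentagon_vertex_in_pentagon pentagon_vertex_in_pentagon] ab k by blast
  then show "x \<in> pentagon \<theta>" using k by simp
qed


lemma mem_pentagon_iff_all: "x \<in> pentagon \<theta> \<longleftrightarrow> (\<forall>k. x \<bullet> pentagon_normal \<theta> k \<le> cos (pi / 5))"
proof -
  have "x \<bullet> pentagon_normal \<theta> k \<le> cos (pi / 5)" if "\<forall>k\<le>4. x \<bullet> pentagon_normal \<theta> k \<le> cos (pi / 5)" for k
  proof -
    have "k mod 5 \<le> 4" by simp
    then have "x \<bullet> pentagon_normal \<theta> (k mod 5) \<le> cos (pi / 5)" using that by blast
    then show ?thesis by (simp only: pentagon_normal_mod_5)
  qed
  then show ?thesis unfolding mem_pentagon_iff by blast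
qed

lemma interior_pentagonI:
  assumes "\<And>k. k \<le> 4 \<Longrightarrow> x \<bullet> pentagon_normal \<theta> k < cos (pi / 5)"
  shows "x \<in> interior (pentagon \<theta>)"
proof (rule interiorI)
  let ?U = "\<Inter>k\<le>4. {x. x \<bullet> pentagon_normal \<theta> k < cos (pi / 5)}"
  show "open ?U"
    by (intro open_INT ballI) (auto simp: open_halfspace_lt inner_commute[of _ "pentagon_normal \<theta> k" for k])
  show "x \<in> ?U" using assms by simp
  show "?U \<subseteq> pentagon \<theta>" by (force simp: mem_pentagon_iff)
qed

lemma zero_in_interior_pentagon: "0 \<in> interior (pentagon \<theta>)"
  by (rule interior_pentagonI) (simp add: cos_pi5_pos)

lemma closed_pentagon: "closed (pentagon \<theta>)"
  unfolding pentagon_def by (intro compact_imp_closed compact_convex_hull finite_imp_compact) simp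

text \<open>An interior point can still be moved a little in the direction \<open>u\<close>, so the
  inequality there cannot be tight.\<close>

lemma inner_normal_cone_interior_neg:
  assumes "y \<in> interior A" "u \<in> normal_cone A x" "u \<noteq> 0"
  shows "u \<bullet> (y - x) < 0"
proof -
  obtain e where e: "e > 0" "ball y e \<subseteq> A" using assms(1) by (meson mem_interior)
  let ?z = "y + (e / (2 * norm u)) *\<^sub>R u"
  have "?z \<in> ball y e" using assms e by (simp add: dist_norm)
  then have "u \<bullet> (?z - x) \<le> 0" using assms(2) e by (auto simp: normal_cone_def)
  then have "u \<bullet> (y - x) + (e / (2 * norm u)) * (u \<bullet> u) \<le> 0"
    by (simp add: inner_diff_right inner_add_right)
  moreover have "(e / (2 * norm u)) * (u \<bullet> u) > 0" using e assms by (intro mult_pos_pos) auto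
  ultimately show ?thesis by simp
qed

text \<open>At an interior point the strict inequality for \<open>y = x\<close> would read
  \<open>0 < 0\<close>.\<close>

lemma normal_cone_imp_frontier:
  assumes "x \<in> A" "u \<in> normal_cone A x" "u \<noteq> 0"
  shows "x \<in> frontier A"
  using assms inner_normal_cone_interior_neg[of x A u x] closure_subset[of A] by (auto simp: frontier_def)

text \<open>Moving one component while the other stays put separates the two conditions.\<close>

lemma normal_cone_Times:
  assumes "x \<in> A" "y \<in> B"
  shows "normal_cone (A \<times> B) (x, y) = normal_cone A x \<times> normal_cone B y"
  using assms by (fastforce simp: normal_cone_def inner_prod_def intro: add_nonpos_nonpos)

lemma normal_cone_hullI:
  assumes "\<And>y. y \<in> S \<Longrightarrow> u \<bullet> y \<le> u \<bullet> x"
  shows "u \<in> normal_cone (convex hull S) x"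
proof -
  have "convex hull S \<subseteq> {y. u \<bullet> y \<le> u \<bullet> x}"
    using assms by (intro hull_minimal convex_halfspace_le) auto
  then show ?thesis by (auto simp: normal_cone_def inner_diff_right)
qed

lemma support_function_normal_cone:
  assumes "x \<in> A" "u \<in> normal_cone A x"
  shows "support_function A u = x \<bullet> u"
  unfolding support_function_def
  by (rule cSup_eq_maximum) (use assms in \<open>auto simp: normal_cone_def inner_commute inner_diff_right\<close>)

text \<open>The point q can be pushed a little against v into the interior of the pentagon.\<close>

lemma inner_normal_cone_pentagon:
  assumes q: "q \<in> pentagon \<theta>" and u: "u \<in> normal_cone (pentagon \<theta>) q"
    and v: "\<And>k. k \<le> 4 \<Longrightarrow> q \<bullet> pentagon_normal \<theta> k = cos (pi / 5) \<Longrightarrow> 0 < v \<bullet> pentagon_normal \<theta> k"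
    and "u \<noteq> 0"
  shows "0 < u \<bullet> v"
proof -
  \<comment> \<open>A tight side inequality becomes strict because \<open>v\<close> has a positive
    product with its normal; a strict one stays strict for small \<open>e\<close> by
    continuity.\<close>
  have "\<forall>\<^sub>F e in at_right 0. (q - e *\<^sub>R v) \<bullet> pentagon_normal \<theta> k < cos (pi / 5)" if k: "k \<le> 4" for k
  proof (cases "q \<bullet> pentagon_normal \<theta> k = cos (pi / 5)")
    case True
    then show ?thesis using v[OF k True]
      by (intro eventually_mono[OF eventually_at_right_less]) (auto simp: inner_diff_left)
  next
    case False
    then have "q \<bullet> pentagon_normal \<theta> k < cos (pi / 5)" using q k by (force simp: mem_pentagon_iff)
    moreover have "((\<lambda>e. (q - e *\<^sub>R v) \<bullet> pentagon_normal \<theta> k) \<longlongrightarrow> (q - 0 *\<^sub>R v) \<bullet> pentagon_normal \<theta> k) (at_right 0)"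
      by (intro tendsto_intros)
    ultimately show ?thesis using order_tendstoD(2) by fastforce
  qed
  then have "\<forall>\<^sub>F e in at_right 0. \<forall>k\<in>{..4}. (q - e *\<^sub>R v) \<bullet> pentagon_normal \<theta> k < cos (pi / 5)"
    by (intro eventually_ball_finite) auto
  then have "\<forall>\<^sub>F e in at_right 0. 0 < e \<and> q - e *\<^sub>R v \<in> interior (pentagon \<theta>)"
    using eventually_at_right_less by eventually_elim (auto intro: interior_pentagonI)
  then obtain e where e: "0 < e" "q - e *\<^sub>R v \<in> interior (pentagon \<theta>)"
    using eventually_happens'[OF trivial_limit_at_right_real] by blast
  then have "e * (u \<bullet> v) > 0"
    using inner_normal_cone_interior_neg[OF e(2) u \<open>u \<noteq> 0\<close>] by simp
  then show ?thesis using e(1) by (simp add: zero_less_mult_iff)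
qed

section \<open>Characteristics of a product\<close>

text \<open>Hamilton's equations on a product, in position and momentum: a normal of the product is
  a pair of normals, which gives the two cone conditions. \<open>N\<close> collects the exceptional
  times, at which nothing is known about \<open>q'\<close> and \<open>p'\<close>.\<close>

locale product_characteristic =
  fixes K T :: "'a::euclidean_space set" and q p q' p' :: "real \<Rightarrow> 'a" and N :: "real set"
  assumes ac_q: "absolutely_continuous_path {0..1} q" and ac_p: "absolutely_continuous_path {0..1} p"
    and closed_q: "q 0 = q 1" and closed_p: "p 0 = p 1"
    and N: "negligible N"
    and deriv_q: "\<And>t. t \<in> {0..1} - N \<Longrightarrow> (q has_vector_derivative q' t) (at t within {0..1})"
    and deriv_p: "\<And>t. t \<in> {0..1} - N \<Longrightarrow> (p has_vector_derivative p' t) (at t within {0..1})"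
    and normal_q: "\<And>t. t \<in> {0..1} - N \<Longrightarrow> q' t \<in> normal_cone T (p t)"
    and normal_p: "\<And>t. t \<in> {0..1} - N \<Longrightarrow> - p' t \<in> normal_cone K (q t)"
    and nonconst: "\<And>t. t \<in> {0..1} - N \<Longrightarrow> q' t \<noteq> 0 \<or> p' t \<noteq> 0"
begin

lemma inner_q:
  "absolutely_continuous_path {0..1} (\<lambda>t. x \<bullet> q t)"
  "t \<in> {0..1} - N \<Longrightarrow> ((\<lambda>t. x \<bullet> q t) has_vector_derivative x \<bullet> q' t) (at t within {0..1})"
  using absolutely_continuous_path_bounded_linear[OF ac_q bounded_linear_inner_right]
    bounded_linear.has_vector_derivative[OF bounded_linear_inner_right deriv_q] by auto

lemma inner_p:
  "absolutely_continuous_path {0..1} (\<lambda>t. x \<bullet> p t)"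
  "t \<in> {0..1} - N \<Longrightarrow> ((\<lambda>t. x \<bullet> p t) has_vector_derivative x \<bullet> p' t) (at t within {0..1})"
  using absolutely_continuous_path_bounded_linear[OF ac_p bounded_linear_inner_right]
    bounded_linear.has_vector_derivative[OF bounded_linear_inner_right deriv_p] by auto

lemma ex_regular_time: "\<exists>t. t \<in> {0..1} - N"
proof (rule ccontr)
  assume "\<not> ?thesis"
  then have "{0..1} \<subseteq> N" by blast
  then have "negligible (cbox 0 (1::real))" using negligible_subset[OF N] by simp
  then have "box 0 (1::real) = {}" by (simp only: negligible_interval)
  then show False using box_ne_empty(2)[of 0 "1::real"] by simp
qed

text \<open>Otherwise \<open>- p \<bullet> v\<close> is monotone, hence p is constant; then \<open>q \<bullet> p\<close> is strictly monotone.\<close>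

lemma no_common_direction:
  assumes T: "0 \<in> interior T"
    and v: "\<And>t u. t \<in> {0..1} \<Longrightarrow> u \<in> normal_cone K (q t) \<Longrightarrow> u \<noteq> 0 \<Longrightarrow> 0 < u \<bullet> v"
  shows False
proof -
  have p0: "p' t = 0" if t: "t \<in> {0..1} - N" for t
  proof -
    have pos: "s \<in> {0..1} - N \<Longrightarrow> p' s \<noteq> 0 \<Longrightarrow> 0 < (- v) \<bullet> p' s" for s
      using v[of s "- p' s"] normal_p[of s] by (simp add: inner_commute)
    have "(- v) \<bullet> p' t = 0"
    proof (rule absolutely_continuous_path_closed_deriv_0[OF inner_p(1) N inner_p(2)])
      show "s \<in> {0..1} - N \<Longrightarrow> 0 \<le> (- v) \<bullet> p' s" for s
        using pos[of s] by (cases "p' s = 0") auto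
    qed (use closed_p t in auto)
    then show ?thesis using pos[OF t] by fastforce
  qed
  have const: "p t = p 0" if t: "t \<in> {0..1}" for t
  proof -
    have "(p' has_integral p t - p 0) {0..t}"
      using fundamental_theorem_of_calculus_absolutely_continuous_subinterval[OF ac_p N deriv_p] t by auto
    moreover have "(p' has_integral 0) {0..t}"
      by (rule has_integral_spike[OF N _ has_integral_0]) (use p0 t in auto)
    ultimately have "p t - p 0 = 0" by (rule has_integral_unique)
    then show ?thesis by simp
  qed
  \<comment> \<open>As \<open>p' t = 0\<close>, the velocity \<open>q' t\<close> is a nonzero normal
    of \<open>T\<close> at \<open>p t\<close>, and the origin is interior to
    \<open>T\<close>.\<close>
  have pos: "0 < p 0 \<bullet> q' t" if t: "t \<in> {0..1} - N" for t
  proof -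
    have "q' t \<bullet> (0 - p t) < 0"
      using inner_normal_cone_interior_neg[OF T normal_q[OF t]] nonconst[OF t] p0[OF t] by blast
    then show ?thesis using const[of t] t by (simp add: inner_commute)
  qed
  obtain t where t: "t \<in> {0..1} - N" using ex_regular_time by blast
  have "p 0 \<bullet> q' t = 0"
    by (rule absolutely_continuous_path_closed_deriv_0[OF inner_q(1) N inner_q(2)])
      (use closed_q t pos in \<open>auto intro: less_imp_le\<close>)
  then show False using pos[OF t] by simp
qed

text \<open>\<open>p\<close> is continuous, hence bounded and measurable, and \<open>q'\<close> is
  absolutely integrable. This allows the action to be cut at the contact times.\<close>

lemma integrable_action: "(\<lambda>t. p t \<bullet> q' t) integrable_on {0..1}"
proof -
  have cont: "continuous_on {0..1} p" using absolutely_continuous_path_imp_continuous_on[OF ac_p] .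
  have "(\<lambda>t. p t \<bullet> q' t) absolutely_integrable_on {0..1}"
  proof (rule absolutely_integrable_bounded_measurable_product[where h = "(\<bullet>)"])
    show "bilinear ((\<bullet>) :: 'a \<Rightarrow> 'a \<Rightarrow> real)"
      by (simp add: bilinear_conv_bounded_bilinear bounded_bilinear_inner)
    show "p \<in> borel_measurable (lebesgue_on {0..1})"
      using cont by (rule continuous_imp_measurable_on_sets_lebesgue) simp
    show "bounded (p ` {0..1})" using compact_continuous_image[OF cont] compact_imp_bounded by blast
    show "q' absolutely_integrable_on {0..1}"
      by (rule absolutely_continuous_path_deriv_absolutely_integrable[OF ac_q N deriv_q])
  qed simp
  then show ?thesis by (rule absolutely_integrable_on_def[THEN iffD1, THEN conjunct1])
qed

text \<open>Off \<open>N\<close> the velocity is normal to \<open>T\<close> at \<open>p t\<close>,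
  so replacing \<open>p t\<close> by any fixed point of \<open>T\<close> can only lower the
  integrand; for a constant momentum the integral is explicit.\<close>

lemma action_ge_segment:
  assumes uv: "0 \<le> u" "u \<le> v" "v \<le> 1" and x: "x \<in> T"
  shows "x \<bullet> (q v - q u) \<le> integral {u..v} (\<lambda>t. p t \<bullet> q' t)"
proof -
  have "((\<lambda>t. x \<bullet> q' t) has_integral x \<bullet> q v - x \<bullet> q u) {u..v}"
    using fundamental_theorem_of_calculus_absolutely_continuous_subinterval[OF inner_q(1) N inner_q(2)] uv by blast
  \<comment> \<open>The comparison of integrals asks for the inequality at every time, so the
    smaller integrand is changed on \<open>N\<close>.\<close>
  then have "((\<lambda>t. if t \<in> N then p t \<bullet> q' t else x \<bullet> q' t) has_integral x \<bullet> (q v - q u)) {u..v}"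
    unfolding inner_diff_right by (rule has_integral_spike[OF N, rotated]) simp
  moreover have "((\<lambda>t. p t \<bullet> q' t) has_integral integral {u..v} (\<lambda>t. p t \<bullet> q' t)) {u..v}"
    using uv by (intro integrable_integral integrable_on_subinterval[OF integrable_action]) auto
  ultimately show ?thesis
  proof (rule has_integral_le)
    fix t assume "t \<in> {u..v}"
    then show "(if t \<in> N then p t \<bullet> q' t else x \<bullet> q' t) \<le> p t \<bullet> q' t"
      using normal_q[of t] uv x by (auto simp: normal_cone_def inner_diff_right inner_commute)
  qed
qed

text \<open>The constant momenta are \<open>x\<close> between \<open>t1\<close> and
  \<open>t2\<close>, \<open>y\<close> between \<open>t2\<close> and \<open>t3\<close>, and
  \<open>z\<close> on the rest of the loop. Summation by parts leaves only the contact points, since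
  the loop closes up.\<close>

lemma action_ge_triangle:
  assumes t: "0 \<le> t1" "t1 \<le> t2" "t2 \<le> t3" "t3 \<le> 1" and T: "x \<in> T" "y \<in> T" "z \<in> T"
  shows "q t1 \<bullet> (z - x) + q t2 \<bullet> (x - y) + q t3 \<bullet> (y - z) \<le> integral {0..1} (\<lambda>t. p t \<bullet> q' t)"
proof -
  let ?f = "\<lambda>t. p t \<bullet> q' t"
  have int: "?f integrable_on {u..v}" if "0 \<le> u" "v \<le> 1" for u v
    using that by (intro integrable_on_subinterval[OF integrable_action]) auto
  have comb: "integral {0..v} ?f = integral {0..u} ?f + integral {u..v} ?f" if "0 \<le> u" "u \<le> v" "v \<le> 1" for u v
    using that int[of 0 v] by (intro Henstock_Kurzweil_Integration.integral_combine[symmetric]) auto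
  have "integral {0..1} ?f = integral {0..t1} ?f + integral {t1..t2} ?f + integral {t2..t3} ?f + integral {t3..1} ?f"
    using comb[of t1 t2] comb[of t2 t3] comb[of t3 1] t by linarith
  moreover have "z \<bullet> (q t1 - q 0) \<le> integral {0..t1} ?f" "x \<bullet> (q t2 - q t1) \<le> integral {t1..t2} ?f"
    "y \<bullet> (q t3 - q t2) \<le> integral {t2..t3} ?f" "z \<bullet> (q 1 - q t3) \<le> integral {t3..1} ?f"
    using t T by (auto intro!: action_ge_segment)
  ultimately show ?thesis
    by (simp add: inner_diff_right inner_diff_left closed_q inner_commute)
qed

end

text \<open>By continuity of \<open>H\<close>, points below the level are interior, so frontier
  points lie on the level. There a subgradient supports the sublevel set, and it is nonzero because
  \<open>H\<close> is not minimal.\<close>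

lemma subgradient_defining_function:
  assumes H: "defining_function S H" and S: "closed S" and x: "x \<in> frontier S" and u: "u \<in> subgradient H x"
  shows "u \<in> normal_cone S x" "u \<noteq> 0"
proof -
  obtain c x0 where c: "convex_on UNIV H" "{x. H x \<le> c} = S" "H x0 < c"
    using H closure_closed[OF S] unfolding defining_function_def by blast
  have "continuous_on UNIV H" using convex_on_continuous[OF open_UNIV c(1)] .
  then have "open {x. H x < c}" by (intro open_Collect_less) auto
  moreover have "{x. H x < c} \<subseteq> {x. H x \<le> c}" by auto
  ultimately have "{x. H x < c} \<subseteq> interior S"
    unfolding c(2) by (rule interior_maximal[rotated])
  moreover have "x \<in> S" "x \<notin> interior S" using x S by (auto simp: frontier_def)
  ultimately have "\<not> H x < c" "H x \<le> c" using c(2) by blast+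
  then have x: "H x = c" by simp
  have "H x + u \<bullet> (x0 - x) \<le> H x0" using u by (simp add: subgradient_def)
  then show "u \<noteq> 0" using c(3) x by auto
  have "u \<bullet> (y - x) \<le> 0" if "y \<in> S" for y
  proof -
    have "H y \<le> c" using that c(2) by blast
    moreover have "H x + u \<bullet> (y - x) \<le> H y" using u by (simp add: subgradient_def)
    ultimately show ?thesis using x by simp
  qed
  then show "u \<in> normal_cone S x" by (simp add: normal_cone_def)
qed

section \<open>The lower bound for two pentagons\<close>

abbreviation K5 :: "(real^2) set" where "K5 \<equiv> pentagon 0"
abbreviation T5 :: "(real^2) set" where "T5 \<equiv> pentagon (- (pi / 2))"
abbreviation T_vert :: "nat \<Rightarrow> real^2" where "T_vert k \<equiv> pentagon_vertex (- (pi / 2)) k"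

text \<open>The first two chords are diagonals of \<open>T\<close>, the last two are edges. They
  point along side normals of \<open>K\<close> because the starting angle \<open>- (pi / 2)\<close>
  cancels the quarter turn in \<open>polar_diff\<close>.\<close>

lemma T_vert_diffs:
  "T_vert (k + 2) - T_vert (k + 4) = (2 * sin (2 * pi / 5)) *\<^sub>R pentagon_normal 0 k"
  "T_vert (k + 4) - T_vert (k + 1) = (2 * sin (2 * pi / 5)) *\<^sub>R pentagon_normal 0 (k + 2)"
  "T_vert (k + 3) - T_vert (k + 2) = (2 * sin (pi / 5)) *\<^sub>R pentagon_normal 0 (k + 2)"
  "T_vert (k + 4) - T_vert (k + 3) = (2 * sin (pi / 5)) *\<^sub>R pentagon_normal 0 (k + 3)"
proof -
  define a where "a = 2 * pi * real k / 5"
  have a: "2 * pi * real (k + j) / 5 = a + 2 * pi * real j / 5" for j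
    by (simp add: a_def field_simps)
  have s: "sin (3 * pi / 5) = sin (2 * pi / 5)"
  proof -
    have "3 * pi / 5 = pi - 2 * pi / 5" by simp
    then show ?thesis by (simp only: sin_pi_minus)
  qed
  have *: "T_vert (k + i) - T_vert (k + j) = (2 * sin (pi * (real i - real j) / 5)) *\<^sub>R polar (a + pi * (real i + real j) / 5)" for i j
  proof -
    have "((- (pi / 2) + 2 * pi * real (k + i) / 5) - (- (pi / 2) + 2 * pi * real (k + j) / 5)) / 2 = pi * (real i - real j) / 5"
      "((- (pi / 2) + 2 * pi * real (k + i) / 5) + (- (pi / 2) + 2 * pi * real (k + j) / 5)) / 2 + pi / 2 = a + pi * (real i + real j) / 5"
      unfolding a by (simp_all add: field_simps)
    then show ?thesis unfolding pentagon_vertex_def polar_diff by (simp only:)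
  qed
  have n: "pentagon_normal 0 (k + j) = polar (a + pi * (1 + 2 * real j) / 5)" for j
    unfolding pentagon_normal_def a by (rule arg_cong[where f = polar]) (simp add: field_simps)
  \<comment> \<open>This chord comes with the negative factor \<open>sin (- 2 * pi / 5)\<close> and
    the opposite direction, so the two signs cancel.\<close>
  have n0: "pentagon_normal 0 k = - polar (a + pi * 6 / 5)"
    unfolding pentagon_normal_def polar_add_pi[symmetric]
    by (rule polar_periodic[symmetric, THEN trans], rule arg_cong[where f = polar]) (simp add: a_def field_simps)
  show "T_vert (k + 2) - T_vert (k + 4) = (2 * sin (2 * pi / 5)) *\<^sub>R pentagon_normal 0 k"
    unfolding * n0 by (simp add: mult.commute)
  show "T_vert (k + 4) - T_vert (k + 1) = (2 * sin (2 * pi / 5)) *\<^sub>R pentagon_normal 0 (k + 2)"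
    using s unfolding * n by (simp add: mult.commute)
  show "T_vert (k + 3) - T_vert (k + 2) = (2 * sin (pi / 5)) *\<^sub>R pentagon_normal 0 (k + 2)"
    "T_vert (k + 4) - T_vert (k + 3) = (2 * sin (pi / 5)) *\<^sub>R pentagon_normal 0 (k + 3)"
    unfolding * n by simp_all
qed

lemma sin_2pi5: "sin (2 * pi / 5) = 2 * sin (pi / 5) * cos (pi / 5)"
  using sin_double[of "pi / 5"] by simp

lemma sin_pi5_pos: "sin (pi / 5) > 0"
  by (intro sin_gt_zero) auto

lemma cos_pi10: "cos (pi / 10) = sin (2 * pi / 5)"
proof -
  have "pi / 10 = pi / 2 - 2 * pi / 5" by simp
  then show ?thesis by (simp only: cos_sin_eq) simp
qed

text \<open>On the left, the value \<open>cos (pi / 5)\<close> taken on each of three sides of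
  \<open>K\<close> is weighted by the lengths of one diagonal and two edges of
  \<open>T\<close>.\<close>

lemma capacity_value:
  "(2 * sin (2 * pi / 5)) * cos (pi / 5) + 2 * (2 * sin (pi / 5)) * cos (pi / 5) =
    2 * cos (pi / 10) * (1 + cos (pi / 5))"
  unfolding cos_pi10 using sin_2pi5 by (simp add: algebra_simps)

text \<open>Two edges and a diagonal of T are parallel to the normals of three sides of K. Both the
  triangle with vertex \<open>T_vert (k + 3)\<close> and its reflection with vertex on the opposite diagonal lie in T.\<close>

lemma inscribed_triangles:
  assumes a: "a \<bullet> pentagon_normal 0 k = cos (pi / 5)" and b: "b \<bullet> pentagon_normal 0 (k + 2) = cos (pi / 5)"
    and c: "c \<bullet> pentagon_normal 0 (k + 3) = cos (pi / 5)"
  shows "\<exists>x\<in>T5. \<exists>y\<in>T5. \<exists>z\<in>T5. a \<bullet> (z - x) + b \<bullet> (x - y) + c \<bullet> (y - z) = 2 * cos (pi / 10) * (1 + cos (pi / 5))"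
    and "\<exists>x\<in>T5. \<exists>y\<in>T5. \<exists>z\<in>T5. b \<bullet> (z - x) + a \<bullet> (x - y) + c \<bullet> (y - z) = 2 * cos (pi / 10) * (1 + cos (pi / 5))"
proof -
  let ?s1 = "2 * sin (2 * pi / 5)" and ?s2 = "2 * sin (pi / 5)"
  note d = T_vert_diffs[of k]
  have val: "a \<bullet> (?s1 *\<^sub>R pentagon_normal 0 k) + b \<bullet> (?s2 *\<^sub>R pentagon_normal 0 (k + 2)) + c \<bullet> (?s2 *\<^sub>R pentagon_normal 0 (k + 3)) =
      2 * cos (pi / 10) * (1 + cos (pi / 5))"
    unfolding capacity_value[symmetric] inner_scaleR_right a b c by simp
  \<comment> \<open>The triangle of the three consecutive vertices \<open>k + 2\<close>,
    \<open>k + 3\<close>, \<open>k + 4\<close> serves the order \<open>b\<close>, \<open>a\<close>,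
    \<open>c\<close>.\<close>
  have "a \<bullet> (T_vert (k + 2) - T_vert (k + 4)) + b \<bullet> (T_vert (k + 3) - T_vert (k + 2)) + c \<bullet> (T_vert (k + 4) - T_vert (k + 3)) = 2 * cos (pi / 10) * (1 + cos (pi / 5))"
    unfolding d using val by simp
  then have "b \<bullet> (T_vert (k + 3) - T_vert (k + 2)) + a \<bullet> (T_vert (k + 2) - T_vert (k + 4)) + c \<bullet> (T_vert (k + 4) - T_vert (k + 3)) = 2 * cos (pi / 10) * (1 + cos (pi / 5))"
    by (simp only: add.commute)
  then show "\<exists>x\<in>T5. \<exists>y\<in>T5. \<exists>z\<in>T5. b \<bullet> (z - x) + a \<bullet> (x - y) + c \<bullet> (y - z) = 2 * cos (pi / 10) * (1 + cos (pi / 5))"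
    using pentagon_vertex_in_pentagon by blast
  \<comment> \<open>\<open>y\<close> is the reflection of \<open>T_vert (k + 3)\<close> in the
    midpoint of the diagonal from \<open>k + 2\<close> to \<open>k + 4\<close>. It lies on the
    diagonal from \<open>k + 4\<close> to \<open>k + 1\<close>, one edge length from
    \<open>k + 4\<close>, and the ratio \<open>?\<mu>\<close> equals
    \<open>1 / (2 * cos (pi / 5))\<close>.\<close>
  let ?\<mu> = "?s2 / ?s1"
  define y where "y = T_vert (k + 4) - ?s2 *\<^sub>R pentagon_normal 0 (k + 2)"
  have y: "y \<in> T5"
  proof -
    have "?s1 > 0" "?s2 > 0" "cos (pi / 5) \<ge> 1 / 2"
      using sin_2pi5_pos sin_pi5_pos cos_monotone_0_pi_le[of "pi / 5" "pi / 3"] cos_60 by simp_all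
    then have "0 \<le> ?\<mu>" "?\<mu> \<le> 1" unfolding sin_2pi5 by (auto simp: field_simps)
    moreover have "y = (1 - ?\<mu>) *\<^sub>R T_vert (k + 4) + ?\<mu> *\<^sub>R T_vert (k + 1)"
    proof -
      have "?\<mu> *\<^sub>R (T_vert (k + 4) - T_vert (k + 1)) = ?s2 *\<^sub>R pentagon_normal 0 (k + 2)"
        unfolding d using sin_2pi5_pos by simp
      then show ?thesis unfolding y_def by (simp add: algebra_simps)
    qed
    ultimately show ?thesis using convex_pentagon pentagon_vertex_in_pentagon unfolding convex_alt by blast
  qed
  have "y - T_vert (k + 2) = ?s2 *\<^sub>R pentagon_normal 0 (k + 3)"
    using d(1) d(3) d(4) unfolding y_def by (simp add: algebra_simps)
  moreover have "T_vert (k + 4) - y = ?s2 *\<^sub>R pentagon_normal 0 (k + 2)" by (simp add: y_def)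
  ultimately have "a \<bullet> (T_vert (k + 2) - T_vert (k + 4)) + b \<bullet> (T_vert (k + 4) - y) + c \<bullet> (y - T_vert (k + 2)) = 2 * cos (pi / 10) * (1 + cos (pi / 5))"
    using val unfolding d by simp
  then show "\<exists>x\<in>T5. \<exists>y\<in>T5. \<exists>z\<in>T5. a \<bullet> (z - x) + b \<bullet> (x - y) + c \<bullet> (y - z) = 2 * cos (pi / 10) * (1 + cos (pi / 5))"
    using pentagon_vertex_in_pentagon y by blast
qed

text \<open>If no two cyclically adjacent positions are missing, the missing ones are contained in
  some pair \<open>k + 1\<close>, \<open>k + 4\<close>. Applied to the sides touched by
  \<open>q\<close>: either three normals positively span the plane, or all of them lie near the
  normal \<open>m\<close>.\<close>

lemma five_cycle_cases:
  fixes P :: "nat \<Rightarrow> bool"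
  assumes P: "\<And>k. P (k + 5) \<longleftrightarrow> P k"
  obtains (triple) k where "P k" "P (k + 2)" "P (k + 3)"
    | (gap) m where "m \<le> 4" "\<not> P (m + 2)" "\<not> P (m + 3)"
proof -
  \<comment> \<open>Indices up to 7 occur, as \<open>k + 3\<close> with
    \<open>k = 4\<close>.\<close>
  have "P 5 = P 0" "P 6 = P 1" "P 7 = P 2"
    using P[of 0] P[of 1] P[of 2] by simp_all
  then show thesis
    using triple[of 0] triple[of 1] triple[of 2] triple[of 3] triple[of 4]
      gap[of 0] gap[of 1] gap[of 2] gap[of 3] gap[of 4]
    by (simp add: numeral_eq_Suc) blast
qed

text \<open>Only \<open>m\<close> and its two neighbours remain, at angles 0 and
  \<open>2 * pi / 5\<close>, which is less than a right angle. So the normal \<open>m\<close> can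
  serve as the common direction.\<close>

lemma inner_pentagon_normal_pos:
  assumes "m \<le> 4" "k \<le> 4" "k \<noteq> (m + 2) mod 5" "k \<noteq> (m + 3) mod 5"
  shows "0 < pentagon_normal 0 m \<bullet> pentagon_normal 0 k"
proof -
  have "k = (m + 0) mod 5 \<or> k = (m + 1) mod 5 \<or> k = (m + 4) mod 5"
  proof -
    have "m = 0 \<or> m = 1 \<or> m = 2 \<or> m = 3 \<or> m = 4" "k = 0 \<or> k = 1 \<or> k = 2 \<or> k = 3 \<or> k = 4"
      using assms(1,2) by auto
    then show ?thesis using assms(3,4) by (elim disjE) simp_all
  qed
  then obtain j :: nat where j: "j = 0 \<or> j = 1 \<or> j = 4" "k = (m + j) mod 5" by blast
  have "pentagon_normal 0 m \<bullet> pentagon_normal 0 k = pentagon_normal 0 m \<bullet> pentagon_normal 0 (m + j)"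
    unfolding j(2) by (simp only: pentagon_normal_mod_5)
  also have "\<dots> = cos (2 * pi * real j / 5)"
  proof -
    have "0 + pi / 5 + 2 * pi * real m / 5 - (0 + pi / 5 + 2 * pi * real (m + j) / 5) = - (2 * pi * real j / 5)"
      by (simp add: field_simps)
    then show ?thesis unfolding pentagon_normal_def inner_polar by (simp only: cos_minus)
  qed
  also have "\<dots> > 0"
  proof -
    have "cos (2 * pi / 5) > 0" by (intro cos_gt_zero) auto
    moreover have "cos (2 * pi * 4 / 5) = cos (2 * pi / 5)"
    proof -
      have "2 * pi * 4 / 5 = 2 * pi - 2 * pi / 5" by simp
      then show ?thesis by (simp only: cos_2pi_minus)
    qed
    ultimately show ?thesis using j(1) by auto
  qed
  finally show ?thesis .
qed

theorem action_lower_bound: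
  assumes "generalized_closed_characteristic (K5 \<times> T5) \<gamma>"
  shows "2 * cos (pi / 10) * (1 + cos (pi / 5)) \<le> action \<gamma>"
proof -
  let ?S = "K5 \<times> T5"
  have S: "closed ?S" by (intro closed_Times closed_pentagon)
  obtain H where ac: "absolutely_continuous_path {0..1} \<gamma>" and loop: "\<gamma> 0 = \<gamma> 1"
    and fr: "\<And>t. t \<in> {0..1} \<Longrightarrow> \<gamma> t \<in> frontier ?S" and H: "defining_function ?S H"
    and AE: "AE t in lebesgue_on {0..1}. \<exists>s>0. \<exists>u\<in>subgradient H (\<gamma> t). (\<gamma> has_vector_derivative s *\<^sub>R J_std u) (at t)"
    using assms unfolding generalized_closed_characteristic_def pathfinish_def pathstart_def path_image_def
    by fastforce
  have "AE t in lebesgue. t \<in> {0..1} \<longrightarrow> (\<exists>s>0. \<exists>u\<in>subgradient H (\<gamma> t). (\<gamma> has_vector_derivative s *\<^sub>R J_std u) (at t))"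
    using AE by (subst (asm) AE_restrict_space_iff) auto
  then obtain N where N: "negligible N" and reg: "\<And>t. t \<in> {0..1} - N \<Longrightarrow>
      \<exists>s>0. \<exists>u\<in>subgradient H (\<gamma> t). (\<gamma> has_vector_derivative s *\<^sub>R J_std u) (at t)"
    unfolding eventually_ae_filter_negligible by blast
  have inS: "fst (\<gamma> t) \<in> K5" "snd (\<gamma> t) \<in> T5" if "t \<in> {0..1}" for t
  proof -
    have "\<gamma> t \<in> ?S" using fr[OF that] S by (auto simp: frontier_def)
    then show "fst (\<gamma> t) \<in> K5" "snd (\<gamma> t) \<in> T5" by (auto simp: mem_Times_iff)
  qed
  define D where "D t = vector_derivative \<gamma> (at t)" for t
  \<comment> \<open>\<open>J_std\<close> sends the normal \<open>(u, v)\<close> to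
    \<open>(v, - u)\<close>: the normal of \<open>T\<close> drives \<open>q\<close> and the negative
    normal of \<open>K\<close> drives \<open>p\<close>. The factor \<open>s > 0\<close> stays within
    the cones.\<close>
  have D: "(\<gamma> has_vector_derivative D t) (at t within {0..1}) \<and> fst (D t) \<in> normal_cone T5 (snd (\<gamma> t)) \<and>
      - snd (D t) \<in> normal_cone K5 (fst (\<gamma> t)) \<and> (fst (D t) \<noteq> 0 \<or> snd (D t) \<noteq> 0)" if t: "t \<in> {0..1} - N" for t
  proof -
    obtain s u where su: "s > 0" "u \<in> subgradient H (\<gamma> t)" "(\<gamma> has_vector_derivative s *\<^sub>R J_std u) (at t)"
      using reg[OF t] by blast
    have Dt: "D t = s *\<^sub>R J_std u" unfolding D_def using su(3) by (rule vector_derivative_at)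
    have "u \<in> normal_cone ?S (\<gamma> t)" and u0: "u \<noteq> 0"
      using subgradient_defining_function[OF H S fr su(2)] t by auto
    then have "fst u \<in> normal_cone K5 (fst (\<gamma> t))" "snd u \<in> normal_cone T5 (snd (\<gamma> t))"
      using normal_cone_Times[OF inS, of t t] t by (auto simp: mem_Times_iff)
    then have "s *\<^sub>R fst u \<in> normal_cone K5 (fst (\<gamma> t))" "s *\<^sub>R snd u \<in> normal_cone T5 (snd (\<gamma> t))"
      using su(1) by (auto simp: normal_cone_def mult_le_0_iff)
    moreover have "(\<gamma> has_vector_derivative D t) (at t within {0..1})"
      using su(3) unfolding Dt by (rule has_vector_derivative_at_within)
    ultimately show ?thesis using u0 su(1) by (auto simp: Dt J_std_def prod_eq_iff)
  qed
  interpret product_characteristic K5 T5 "\<lambda>t. fst (\<gamma> t)" "\<lambda>t. snd (\<gamma> t)" "\<lambda>t. fst (D t)" "\<lambda>t. snd (D t)" N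
  proof
    show "absolutely_continuous_path {0..1} (\<lambda>t. fst (\<gamma> t))" "absolutely_continuous_path {0..1} (\<lambda>t. snd (\<gamma> t))"
      using absolutely_continuous_path_bounded_linear[OF ac] bounded_linear_fst bounded_linear_snd by auto
    show "((\<lambda>t. fst (\<gamma> t)) has_vector_derivative fst (D t)) (at t within {0..1})"
      "((\<lambda>t. snd (\<gamma> t)) has_vector_derivative snd (D t)) (at t within {0..1})" if "t \<in> {0..1} - N" for t
      using D[OF that] bounded_linear.has_vector_derivative[OF bounded_linear_fst]
        bounded_linear.has_vector_derivative[OF bounded_linear_snd] by blast+
  qed (use loop N D inS in auto)
  have "action \<gamma> = \<bar>integral {0..1} (\<lambda>t. snd (\<gamma> t) \<bullet> fst (D t))\<bar>" (is "_ = \<bar>?A\<bar>")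
    by (simp add: action_def D_def)
  also have "\<dots> \<ge> ?A" by simp
  finally have act: "?A \<le> action \<gamma>" .
  \<comment> \<open>\<open>P k\<close> says that \<open>q\<close> touches side \<open>k\<close> of
    \<open>K\<close> at some time.\<close>
  define P where "P k = (\<exists>t\<in>{0..1}. fst (\<gamma> t) \<bullet> pentagon_normal 0 k = cos (pi / 5))" for k
  have "P (k + 5) = P k" for k unfolding P_def by (simp only: pentagon_normal_add_5)
  then show ?thesis
  proof (cases rule: five_cycle_cases)
    case (triple k)
    then obtain ta tb tc where t: "ta \<in> {0..1}" "tb \<in> {0..1}" "tc \<in> {0..1}"
      "fst (\<gamma> ta) \<bullet> pentagon_normal 0 k = cos (pi / 5)" "fst (\<gamma> tb) \<bullet> pentagon_normal 0 (k + 2) = cos (pi / 5)"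
      "fst (\<gamma> tc) \<bullet> pentagon_normal 0 (k + 3) = cos (pi / 5)"
      unfolding P_def by blast
    let ?C = "2 * cos (pi / 10) * (1 + cos (pi / 5))"
    obtain x y z where xyz: "x \<in> T5" "y \<in> T5" "z \<in> T5"
      "fst (\<gamma> ta) \<bullet> (z - x) + fst (\<gamma> tb) \<bullet> (x - y) + fst (\<gamma> tc) \<bullet> (y - z) = ?C"
      using inscribed_triangles(1)[OF t(4,5,6)] by blast
    obtain x' y' z' where xyz': "x' \<in> T5" "y' \<in> T5" "z' \<in> T5"
      "fst (\<gamma> tb) \<bullet> (z' - x') + fst (\<gamma> ta) \<bullet> (x' - y') + fst (\<gamma> tc) \<bullet> (y' - z') = ?C"
      using inscribed_triangles(2)[OF t(4,5,6)] by blast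
    \<comment> \<open>Rotating an order of the contact times only renames the corners of the
      triangle; the two cyclic orders need the two different triangles.\<close>
    consider "ta \<le> tb" "tb \<le> tc" | "tb \<le> tc" "tc \<le> ta" | "tc \<le> ta" "ta \<le> tb"
      | "tb \<le> ta" "ta \<le> tc" | "ta \<le> tc" "tc \<le> tb" | "tc \<le> tb" "tb \<le> ta" by linarith
    then have "?C \<le> ?A"
    proof cases
      case 1 then show ?thesis using action_ge_triangle[of ta tb tc x y z] t(1-3) xyz by auto
    next
      case 2 then show ?thesis using action_ge_triangle[of tb tc ta y z x] t(1-3) xyz by auto
    next
      case 3 then show ?thesis using action_ge_triangle[of tc ta tb z x y] t(1-3) xyz by auto
    next
      case 4 then show ?thesis using action_ge_triangle[of tb ta tc x' y' z'] t(1-3) xyz' by auto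
    next
      case 5 then show ?thesis using action_ge_triangle[of ta tc tb y' z' x'] t(1-3) xyz' by auto
    next
      case 6 then show ?thesis using action_ge_triangle[of tc tb ta z' x' y'] t(1-3) xyz' by auto
    qed
    then show ?thesis using act by linarith
  next
    case (gap m)
    have "0 < pentagon_normal 0 m \<bullet> pentagon_normal 0 k" if "k \<le> 4" "fst (\<gamma> t) \<bullet> pentagon_normal 0 k = cos (pi / 5)" "t \<in> {0..1}" for k t
    proof (rule inner_pentagon_normal_pos[OF gap(1) that(1)])
      have "\<not> P ((m + 2) mod 5)" "\<not> P ((m + 3) mod 5)" using gap(2,3) unfolding P_def pentagon_normal_mod_5 by blast+
      moreover have "P k" using that unfolding P_def by blast
      ultimately show "k \<noteq> (m + 2) mod 5" "k \<noteq> (m + 3) mod 5" by blast+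
    qed
    then have False
      using inner_normal_cone_pentagon[OF inS(1)]
      by (intro no_common_direction[OF zero_in_interior_pentagon, of "pentagon_normal 0 m"]) blast
    then show ?thesis ..
  qed
qed

section \<open>Two-bounce characteristics\<close>

definition polar_set :: "'a::real_inner set \<Rightarrow> 'a set" where
  "polar_set S = {u. \<forall>x\<in>S. u \<bullet> x \<le> 1}"

text \<open>A small multiple of \<open>y\<close> lies in \<open>S\<close>, which bounds the products
  uniformly, so the supremum in the support function is meaningful.\<close>

lemma bdd_above_polar_set:
  fixes S :: "'a::real_inner set"
  assumes "0 \<in> interior S"
  shows "bdd_above ((\<lambda>u. u \<bullet> y) ` polar_set S)"
proof (cases "y = 0")
  case False
  obtain e where e: "e > 0" "ball 0 e \<subseteq> S" using assms by (meson mem_interior)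
  have "(e / (2 * norm y)) *\<^sub>R y \<in> ball 0 e" using False e by simp
  then have "(e / (2 * norm y)) *\<^sub>R y \<in> S" using e by blast
  then have "u \<bullet> (e / (2 * norm y)) *\<^sub>R y \<le> 1" if "u \<in> polar_set S" for u
    using that unfolding polar_set_def by blast
  then have "u \<bullet> y \<le> 2 * norm y / e" if "u \<in> polar_set S" for u
    using that False e by (fastforce simp: field_simps)
  then show ?thesis by (intro bdd_aboveI2)
qed auto

lemma zero_in_polar_set: "0 \<in> polar_set S"
  by (simp add: polar_set_def)

lemma inner_le_support_polar_set:
  "0 \<in> interior S \<Longrightarrow> u \<in> polar_set S \<Longrightarrow> u \<bullet> y \<le> support_function (polar_set S) y"
  unfolding support_function_def by (intro cSUP_upper bdd_above_polar_set)

text \<open>The support function of the polar set is the gauge function.\<close>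

lemma defining_function_support_polar_set:
  fixes S :: "'a::euclidean_space set"
  assumes S: "convex S" "closed S" and 0: "0 \<in> interior S"
  shows "defining_function S (support_function (polar_set S))" (is "defining_function S ?H")
proof -
  note ge = inner_le_support_polar_set[OF 0]
  have least: "?H y \<le> r" if "\<And>u. u \<in> polar_set S \<Longrightarrow> u \<bullet> y \<le> r" for y r
    unfolding support_function_def using that zero_in_polar_set[of S] by (intro cSUP_least) auto
  have "convex_on UNIV ?H"
  proof (intro convex_onI least)
    fix t x y u assume t: "0 < t" "t < (1::real)" and u: "u \<in> polar_set S"
    have "u \<bullet> ((1 - t) *\<^sub>R x + t *\<^sub>R y) = (1 - t) * (u \<bullet> x) + t * (u \<bullet> y)"
      by (simp add: inner_add_right)
    also have "\<dots> \<le> (1 - t) * ?H x + t * ?H y"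
      using t ge[OF u] by (intro add_mono mult_left_mono) auto
    finally show "u \<bullet> ((1 - t) *\<^sub>R x + t *\<^sub>R y) \<le> (1 - t) * ?H x + t * ?H y" .
  qed simp
  moreover have "{x. ?H x \<le> 1} = S"
  proof (intro set_eqI iffI)
    fix x assume "x \<in> S"
    then have "?H x \<le> 1" by (intro least) (simp add: polar_set_def)
    then show "x \<in> {x. ?H x \<le> 1}" by simp
  next
    fix x assume x: "x \<in> {x. ?H x \<le> 1}"
    show "x \<in> S"
    proof (rule ccontr)
      assume "x \<notin> S"
      \<comment> \<open>The origin lies in \<open>S\<close>, so \<open>b\<close> is negative;
        dividing by it reverses both inequalities and yields an element of the polar set whose
        product with \<open>x\<close> exceeds 1.\<close>
      then obtain a b where ab: "a \<bullet> x < b" "\<And>y. y \<in> S \<Longrightarrow> b < a \<bullet> y"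
        using separating_hyperplane_closed_point[OF S] by blast
      have "0 \<in> S" using 0 interior_subset by blast
      then have b: "b < 0" using ab(2)[of 0] by simp
      have "(1 / b) *\<^sub>R a \<in> polar_set S"
        using ab(2) b by (auto simp: polar_set_def divide_le_eq intro: less_imp_le)
      then have "((1 / b) *\<^sub>R a) \<bullet> x \<le> 1" using ge[of _ x] x by force
      then show False using ab(1) b by (simp add: divide_le_eq)
    qed
  qed
  moreover have "?H 0 < 1" using least[of 0 0] by auto
  ultimately show ?thesis
    unfolding defining_function_def using S(2) by (intro conjI exI[of _ 1] exI[of _ 0]) auto
qed

text \<open>Scaled to have product 1 with \<open>z\<close>, the normal lies in the polar set and
  attains the gauge at \<open>z\<close>; an element attaining the supremum is a subgradient. The
  scale \<open>s\<close> is \<open>u \<bullet> z\<close>.\<close>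

lemma normal_cone_imp_subgradient:
  fixes S :: "'a::euclidean_space set"
  assumes S: "convex S" "closed S" and 0: "0 \<in> interior S"
    and z: "z \<in> S" and u: "u \<in> normal_cone S z" "u \<noteq> 0"
  obtains s where "0 < s" "(1 / s) *\<^sub>R u \<in> subgradient (support_function (polar_set S)) z"
proof -
  let ?H = "support_function (polar_set S)"
  have pos: "0 < u \<bullet> z" using inner_normal_cone_interior_neg[OF 0 u] by simp
  let ?v = "(1 / (u \<bullet> z)) *\<^sub>R u"
  have v: "?v \<in> polar_set S"
    using u(1) pos by (auto simp: polar_set_def normal_cone_def inner_diff_right divide_le_eq)
  have "?H z \<le> 1"
    unfolding support_function_def
  proof (rule cSUP_least)
    show "polar_set S \<noteq> {}" using zero_in_polar_set by blast
  qed (use z in \<open>simp add: polar_set_def\<close>)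
  moreover have "?v \<bullet> z = 1" using pos by simp
  moreover note inner_le_support_polar_set[OF 0 v]
  ultimately have "?v \<in> subgradient ?H z"
    unfolding subgradient_def inner_diff_right by (smt (verit, best) mem_Collect_eq)
  then show thesis using that pos by blast
qed

text \<open>The billiard conditions for two bounces with momenta \<open>p1\<close> and
  \<open>p2\<close>, freed of cyclic indices. Distinctness of the points makes the loop move on
  every segment.\<close>

definition two_bounce :: "'a::real_inner set \<Rightarrow> 'a set \<Rightarrow> 'a \<Rightarrow> 'a \<Rightarrow> 'a \<Rightarrow> 'a \<Rightarrow> bool" where
  "two_bounce K T q1 q2 p1 p2 \<longleftrightarrow> q1 \<in> K \<and> q2 \<in> K \<and> p1 \<in> T \<and> p2 \<in> T \<and> q1 \<noteq> q2 \<and> p1 \<noteq> p2 \<and>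
    q2 - q1 \<in> normal_cone T p1 \<and> q1 - q2 \<in> normal_cone T p2 \<and>
    p1 - p2 \<in> normal_cone K q2 \<and> p2 - p1 \<in> normal_cone K q1"

lemma two_bounce_commute: "two_bounce K T q1 q2 p1 p2 \<Longrightarrow> two_bounce K T q2 q1 p2 p1"
  by (auto simp: two_bounce_def)

lemma closed_billiard_trajectory_two_bounce:
  assumes "two_bounce K T q1 q2 p1 p2"
  shows "closed_billiard_trajectory T K [q1, q2]"
proof -
  have fr: "q1 \<in> frontier K" "q2 \<in> frontier K" "p1 \<in> frontier T" "p2 \<in> frontier T"
    using assms normal_cone_imp_frontier unfolding two_bounce_def
    by (metis right_minus_eq)+
  have "p2 - p1 \<in> uminus ` normal_cone K q2" "p1 - p2 \<in> uminus ` normal_cone K q1"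
    using assms unfolding two_bounce_def by (metis imageI minus_diff_eq)+
  then show ?thesis
    using fr assms unfolding closed_billiard_trajectory_def two_bounce_def
    by (auto intro!: exI[of _ "[p1, p2]"] simp: less_Suc_eq numeral_2_eq_2 Let_def)
qed

lemma polygon_length_2:
  "polygon_length T [q1, q2] = support_function T (q2 - q1) + support_function T (q1 - q2)"
  by (simp add: polygon_length_def numeral_2_eq_2)

lemma support_function_two_bounce:
  assumes "two_bounce K T q1 q2 p1 p2"
  shows "support_function T (q2 - q1) = p1 \<bullet> (q2 - q1)" "support_function T (q1 - q2) = p2 \<bullet> (q1 - q2)"
  using assms support_function_normal_cone unfolding two_bounce_def by blast+

section \<open>The loop of a two-bounce trajectory\<close>

definition ramp :: "real \<Rightarrow> real" where
  "ramp t = max 0 (min 1 t)"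

lemma ramp_lipschitz: "\<bar>ramp s - ramp t\<bar> \<le> \<bar>s - t\<bar>"
  by (auto simp: ramp_def max_def min_def)

text \<open>Both coefficients are trapezoidal waves a quarter period apart, so one component moves
  while the other rests. A single formula built from \<open>ramp\<close> gives the Lipschitz bound
  without case distinctions.\<close>

definition two_bounce_loop :: "'a::real_vector \<Rightarrow> 'a \<Rightarrow> 'a \<Rightarrow> 'a \<Rightarrow> real \<Rightarrow> 'a \<times> 'a" where
  "two_bounce_loop q1 q2 p1 p2 t =
    (q1 + (ramp (4 * t) - ramp (4 * t - 2)) *\<^sub>R (q2 - q1),
     p1 + (ramp (4 * t - 1) - ramp (4 * t - 3)) *\<^sub>R (p2 - p1))"

lemma two_bounce_loop_pieces:
  fixes q1 :: "'a::real_vector"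
  shows
  "0 \<le> t \<Longrightarrow> t \<le> 1/4 \<Longrightarrow> two_bounce_loop q1 q2 p1 p2 t = (q1 + (4 * t) *\<^sub>R (q2 - q1), p1)"
  "1/4 \<le> t \<Longrightarrow> t \<le> 1/2 \<Longrightarrow> two_bounce_loop q1 q2 p1 p2 t = (q2, p1 + (4 * t - 1) *\<^sub>R (p2 - p1))"
  "1/2 \<le> t \<Longrightarrow> t \<le> 3/4 \<Longrightarrow> two_bounce_loop q1 q2 p1 p2 t = (q2 + (4 * t - 2) *\<^sub>R (q1 - q2), p2)"
  "3/4 \<le> t \<Longrightarrow> t \<le> 1 \<Longrightarrow> two_bounce_loop q1 q2 p1 p2 t = (q1, p2 + (4 * t - 3) *\<^sub>R (p1 - p2))"
proof -
  let ?c = "ramp (4 * t) - ramp (4 * t - 2)" and ?d = "ramp (4 * t - 1) - ramp (4 * t - 3)"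
  have swap: "a + (1 - s) *\<^sub>R (b - a) = b + s *\<^sub>R (a - b)" for a b :: 'a and s
    by (simp add: algebra_simps)
  show "two_bounce_loop q1 q2 p1 p2 t = (q1 + (4 * t) *\<^sub>R (q2 - q1), p1)" if "0 \<le> t" "t \<le> 1/4"
  proof -
    have c: "?c = 4 * t" and d: "?d = 0" using that by (auto simp: ramp_def)
    show ?thesis unfolding two_bounce_loop_def c d by simp
  qed
  show "two_bounce_loop q1 q2 p1 p2 t = (q2, p1 + (4 * t - 1) *\<^sub>R (p2 - p1))" if "1/4 \<le> t" "t \<le> 1/2"
  proof -
    have c: "?c = 1" and d: "?d = 4 * t - 1" using that by (auto simp: ramp_def)
    show ?thesis unfolding two_bounce_loop_def c d by simp
  qed
  show "two_bounce_loop q1 q2 p1 p2 t = (q2 + (4 * t - 2) *\<^sub>R (q1 - q2), p2)" if "1/2 \<le> t" "t \<le> 3/4"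
  proof -
    have c: "?c = 1 - (4 * t - 2)" and d: "?d = 1" using that by (auto simp: ramp_def)
    show ?thesis unfolding two_bounce_loop_def c d swap by simp
  qed
  show "two_bounce_loop q1 q2 p1 p2 t = (q1, p2 + (4 * t - 3) *\<^sub>R (p1 - p2))" if "3/4 \<le> t" "t \<le> 1"
  proof -
    have c: "?c = 0" and d: "?d = 1 - (4 * t - 3)" using that by (auto simp: ramp_def)
    show ?thesis unfolding two_bounce_loop_def c d swap by simp
  qed
qed

lemma two_bounce_loop_absolutely_continuous:
  "absolutely_continuous_path I (two_bounce_loop q1 q2 p1 p2)"
proof (rule Lipschitz_imp_absolutely_continuous_path, rule lipschitz_onI)
  fix s t :: real
  let ?c = "\<lambda>t. ramp (4 * t) - ramp (4 * t - 2)" and ?d = "\<lambda>t. ramp (4 * t - 1) - ramp (4 * t - 3)"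
  have ramp: "\<bar>ramp (4 * s - c) - ramp (4 * t - c)\<bar> \<le> 4 * \<bar>s - t\<bar>" for c
  proof -
    have "\<bar>4 * s - c - (4 * t - c)\<bar> = 4 * \<bar>s - t\<bar>" by (simp add: abs_if)
    then show ?thesis using ramp_lipschitz[of "4 * s - c" "4 * t - c"] by simp
  qed
  have cd: "\<bar>?c s - ?c t\<bar> \<le> 8 * \<bar>s - t\<bar>" "\<bar>?d s - ?d t\<bar> \<le> 8 * \<bar>s - t\<bar>"
    using ramp[of 0, unfolded diff_zero] ramp[of 1] ramp[of 2] ramp[of 3] by linarith+
  have "two_bounce_loop q1 q2 p1 p2 s - two_bounce_loop q1 q2 p1 p2 t =
      ((?c s - ?c t) *\<^sub>R (q2 - q1), (?d s - ?d t) *\<^sub>R (p2 - p1))"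
    by (simp add: two_bounce_loop_def scaleR_diff_left)
  then have "dist (two_bounce_loop q1 q2 p1 p2 s) (two_bounce_loop q1 q2 p1 p2 t)
      \<le> \<bar>?c s - ?c t\<bar> * norm (q2 - q1) + \<bar>?d s - ?d t\<bar> * norm (p2 - p1)"
    unfolding dist_norm by (metis norm_Pair_le norm_scaleR real_norm_def)
  also have "\<dots> \<le> (8 * \<bar>s - t\<bar>) * norm (q2 - q1) + (8 * \<bar>s - t\<bar>) * norm (p2 - p1)"
    using cd by (intro add_mono mult_right_mono) auto
  finally show "dist (two_bounce_loop q1 q2 p1 p2 s) (two_bounce_loop q1 q2 p1 p2 t)
      \<le> (8 * (norm (q2 - q1) + norm (p2 - p1))) * dist s t"
    by (simp add: dist_real_def algebra_simps)
qed simp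

lemma two_bounce_loop_derivs:
  fixes q1 :: "'a::real_normed_vector"
  shows
  "t \<in> {0<..<1/4} \<Longrightarrow> (two_bounce_loop q1 q2 p1 p2 has_vector_derivative (4 *\<^sub>R (q2 - q1), 0)) (at t)"
  "t \<in> {1/4<..<1/2} \<Longrightarrow> (two_bounce_loop q1 q2 p1 p2 has_vector_derivative (0, 4 *\<^sub>R (p2 - p1))) (at t)"
  "t \<in> {1/2<..<3/4} \<Longrightarrow> (two_bounce_loop q1 q2 p1 p2 has_vector_derivative (4 *\<^sub>R (q1 - q2), 0)) (at t)"
  "t \<in> {3/4<..<1} \<Longrightarrow> (two_bounce_loop q1 q2 p1 p2 has_vector_derivative (0, 4 *\<^sub>R (p1 - p2))) (at t)"
proof -
  have lin: "((\<lambda>t. (x + (4 * t - c) *\<^sub>R v, y + (4 * t - c) *\<^sub>R w)) has_vector_derivative (4 *\<^sub>R v, 4 *\<^sub>R w)) (at t)"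
    for x y v w :: 'a and c t :: real
    by (auto intro!: derivative_eq_intros has_vector_derivative_Pair)
  show "(two_bounce_loop q1 q2 p1 p2 has_vector_derivative (4 *\<^sub>R (q2 - q1), 0)) (at t)" if "t \<in> {0<..<1/4}"
    by (rule has_vector_derivative_transform_within_open[OF _ open_greaterThanLessThan that])
      (use lin[of q1 0 "q2 - q1" p1 0 t] in \<open>auto simp: two_bounce_loop_pieces(1)\<close>)
  show "(two_bounce_loop q1 q2 p1 p2 has_vector_derivative (0, 4 *\<^sub>R (p2 - p1))) (at t)" if "t \<in> {1/4<..<1/2}"
    by (rule has_vector_derivative_transform_within_open[OF _ open_greaterThanLessThan that])
      (use lin[of q2 1 0 p1 "p2 - p1" t] in \<open>auto simp: two_bounce_loop_pieces(2)\<close>)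
  show "(two_bounce_loop q1 q2 p1 p2 has_vector_derivative (4 *\<^sub>R (q1 - q2), 0)) (at t)" if "t \<in> {1/2<..<3/4}"
    by (rule has_vector_derivative_transform_within_open[OF _ open_greaterThanLessThan that])
      (use lin[of q2 2 "q1 - q2" p2 0 t] in \<open>auto simp: two_bounce_loop_pieces(3)\<close>)
  show "(two_bounce_loop q1 q2 p1 p2 has_vector_derivative (0, 4 *\<^sub>R (p1 - p2))) (at t)" if "t \<in> {3/4<..<1}"
    by (rule has_vector_derivative_transform_within_open[OF _ open_greaterThanLessThan that])
      (use lin[of q1 3 0 p2 "p1 - p2" t] in \<open>auto simp: two_bounce_loop_pieces(4)\<close>)
qed


lemma quarter_cases:
  fixes t :: real
  assumes "t \<in> {0..1}"
  obtains "0 \<le> t" "t \<le> 1/4" | "1/4 \<le> t" "t \<le> 1/2" | "1/2 \<le> t" "t \<le> 3/4" | "3/4 \<le> t" "t \<le> 1"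
  using assms by fastforce

lemma convex_segment_mem:
  assumes "convex A" "a \<in> A" "b \<in> A" "0 \<le> s" "s \<le> 1"
  shows "a + s *\<^sub>R (b - a) \<in> A"
proof -
  have "a + s *\<^sub>R (b - a) = (1 - s) *\<^sub>R a + s *\<^sub>R b" by (simp add: algebra_simps)
  then show ?thesis using assms by (simp add: convex_alt)
qed

text \<open>On each quarter the resting component sits at a point whose normal cone contains, up to
  sign, the velocity of the moving one. Paired with 0 this is a normal of the product that
  \<open>J_std\<close> turns into the velocity. Only the break points are exceptional.\<close>

theorem generalized_closed_characteristic_two_bounce:
  fixes K T :: "'a::euclidean_space set"
  assumes tb: "two_bounce K T q1 q2 p1 p2"
    and K: "convex K" "closed K" "0 \<in> interior K" and T: "convex T" "closed T" "0 \<in> interior T"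
  shows "generalized_closed_characteristic (K \<times> T) (two_bounce_loop q1 q2 p1 p2)"
proof -
  let ?\<gamma> = "two_bounce_loop q1 q2 p1 p2" and ?S = "K \<times> T"
  let ?H = "support_function (polar_set ?S)"
  note tb' = tb[unfolded two_bounce_def]
  have S: "convex ?S" "closed ?S" "0 \<in> interior ?S"
    using K T by (auto simp: convex_Times closed_Times interior_Times zero_prod_def)
  have nc: "(u, v) \<in> normal_cone ?S (x, y)" if "x \<in> K" "y \<in> T" "u \<in> normal_cone K x" "v \<in> normal_cone T y" for u v x y
    using normal_cone_Times[OF that(1,2)] that by simp
  have sc: "r *\<^sub>R u \<in> normal_cone A x" if "0 \<le> r" "u \<in> normal_cone A x" for r u x and A :: "'a set"
    using that by (auto simp: normal_cone_def mult_nonneg_nonpos)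
  have zero: "0 \<in> normal_cone A x" for x and A :: "'a set" by (simp add: normal_cone_def)
  have seg: "a + s *\<^sub>R (b - a) \<in> A" if "convex A" "a \<in> A" "b \<in> A" "0 \<le> s" "s \<le> 1" for a b s and A :: "'a set"
    using convex_segment_mem[OF that] .
  have mem: "?\<gamma> t \<in> ?S" and normal:
     "0 \<le> t \<Longrightarrow> t \<le> 1/4 \<Longrightarrow> (0, 4 *\<^sub>R (q2 - q1)) \<in> normal_cone ?S (?\<gamma> t)"
     "1/4 \<le> t \<Longrightarrow> t \<le> 1/2 \<Longrightarrow> (4 *\<^sub>R (p1 - p2), 0) \<in> normal_cone ?S (?\<gamma> t)"
     "1/2 \<le> t \<Longrightarrow> t \<le> 3/4 \<Longrightarrow> (0, 4 *\<^sub>R (q1 - q2)) \<in> normal_cone ?S (?\<gamma> t)"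
     "3/4 \<le> t \<Longrightarrow> t \<le> 1 \<Longrightarrow> (4 *\<^sub>R (p2 - p1), 0) \<in> normal_cone ?S (?\<gamma> t)"
    if "t \<in> {0..1}" for t
  proof -
    show "?\<gamma> t \<in> ?S"
      using that by (cases t rule: quarter_cases) (use tb' K(1) T(1) in \<open>auto simp: two_bounce_loop_pieces intro!: seg\<close>)
    show "(0, 4 *\<^sub>R (q2 - q1)) \<in> normal_cone ?S (?\<gamma> t)" if "0 \<le> t" "t \<le> 1/4"
      unfolding two_bounce_loop_pieces(1)[OF that]
      by (rule nc) (use tb' K(1) that in \<open>auto intro!: seg sc zero\<close>)
    show "(4 *\<^sub>R (p1 - p2), 0) \<in> normal_cone ?S (?\<gamma> t)" if "1/4 \<le> t" "t \<le> 1/2"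
      unfolding two_bounce_loop_pieces(2)[OF that]
      by (rule nc) (use tb' T(1) that in \<open>auto intro!: seg sc zero\<close>)
    show "(0, 4 *\<^sub>R (q1 - q2)) \<in> normal_cone ?S (?\<gamma> t)" if "1/2 \<le> t" "t \<le> 3/4"
      unfolding two_bounce_loop_pieces(3)[OF that]
      by (rule nc) (use tb' K(1) that in \<open>auto intro!: seg sc zero\<close>)
    show "(4 *\<^sub>R (p2 - p1), 0) \<in> normal_cone ?S (?\<gamma> t)" if "3/4 \<le> t" "t \<le> 1"
      unfolding two_bounce_loop_pieces(4)[OF that]
      by (rule nc) (use tb' T(1) that in \<open>auto intro!: seg sc zero\<close>)
  qed
  have ne: "4 *\<^sub>R (q2 - q1) \<noteq> 0" "4 *\<^sub>R (q1 - q2) \<noteq> 0" "4 *\<^sub>R (p2 - p1) \<noteq> 0" "4 *\<^sub>R (p1 - p2) \<noteq> 0"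
    using tb' by auto
  have fr: "?\<gamma> t \<in> frontier ?S" if t: "t \<in> {0..1}" for t
    using t
  proof (cases t rule: quarter_cases)
    case 1
    then show ?thesis using ne normal_cone_imp_frontier[OF mem[OF t] normal(1)[OF t]] by (simp add: zero_prod_def)
  next
    case 2
    then show ?thesis using ne normal_cone_imp_frontier[OF mem[OF t] normal(2)[OF t]] by (simp add: zero_prod_def)
  next
    case 3
    then show ?thesis using ne normal_cone_imp_frontier[OF mem[OF t] normal(3)[OF t]] by (simp add: zero_prod_def)
  next
    case 4
    then show ?thesis using ne normal_cone_imp_frontier[OF mem[OF t] normal(4)[OF t]] by (simp add: zero_prod_def)
  qed
  \<comment> \<open>The normal \<open>w\<close> with the right velocity need not be a subgradient of
    the gauge, but a positive multiple is; the free factor \<open>s\<close> compensates.\<close>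
  have reg: "\<exists>s>0. \<exists>u\<in>subgradient ?H (?\<gamma> t). (?\<gamma> has_vector_derivative s *\<^sub>R J_std u) (at t)"
    if t: "t \<in> {0..1}" and D: "(?\<gamma> has_vector_derivative J_std w) (at t)"
      and w: "w \<in> normal_cone ?S (?\<gamma> t)" "w \<noteq> 0" for t w
  proof -
    obtain s where s: "0 < s" "(1 / s) *\<^sub>R w \<in> subgradient ?H (?\<gamma> t)"
      using normal_cone_imp_subgradient[OF S mem[OF t] w] .
    have "s *\<^sub>R J_std ((1 / s) *\<^sub>R w) = J_std w" using s(1) by (simp add: J_std_def)
    then show ?thesis using s D by metis
  qed
  have "AE t in lebesgue_on {0..1}. \<exists>s>0. \<exists>u\<in>subgradient ?H (?\<gamma> t). (?\<gamma> has_vector_derivative s *\<^sub>R J_std u) (at t)"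
  proof (rule AE_I')
    show "{0, 1/4, 1/2, 3/4, 1} \<in> null_sets (lebesgue_on {0..1::real})"
      by (subst null_sets_restrict_space) (auto intro: negligible_iff_null_sets[THEN iffD1])
    show "{t \<in> space (lebesgue_on {0..1}). \<not> (\<exists>s>0. \<exists>u\<in>subgradient ?H (?\<gamma> t). (?\<gamma> has_vector_derivative s *\<^sub>R J_std u) (at t))}
       \<subseteq> {0, 1/4, 1/2, 3/4, 1}"
    proof (rule subsetI, rule ccontr)
      fix t
      assume t: "t \<in> {t \<in> space (lebesgue_on {0..1}). \<not> (\<exists>s>0. \<exists>u\<in>subgradient ?H (?\<gamma> t). (?\<gamma> has_vector_derivative s *\<^sub>R J_std u) (at t))}"
        and nt: "t \<notin> {0, 1/4, 1/2, 3/4, 1}"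
      then have t01: "t \<in> {0..1}" by simp
      have "\<exists>w. (?\<gamma> has_vector_derivative J_std w) (at t) \<and> w \<in> normal_cone ?S (?\<gamma> t) \<and> w \<noteq> 0"
        using t01
      proof (cases t rule: quarter_cases)
        case 1
        then show ?thesis using two_bounce_loop_derivs(1)[of t q1 q2 p1 p2] normal(1)[OF t01] ne nt
          by (intro exI[of _ "(0, 4 *\<^sub>R (q2 - q1))"]) (auto simp: J_std_def zero_prod_def)
      next
        case 2
        then show ?thesis using two_bounce_loop_derivs(2)[of t q1 q2 p1 p2] normal(2)[OF t01] ne nt
          by (intro exI[of _ "(4 *\<^sub>R (p1 - p2), 0)"]) (auto simp: J_std_def zero_prod_def algebra_simps)
      next
        case 3
        then show ?thesis using two_bounce_loop_derivs(3)[of t q1 q2 p1 p2] normal(3)[OF t01] ne nt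
          by (intro exI[of _ "(0, 4 *\<^sub>R (q1 - q2))"]) (auto simp: J_std_def zero_prod_def)
      next
        case 4
        then show ?thesis using two_bounce_loop_derivs(4)[of t q1 q2 p1 p2] normal(4)[OF t01] ne nt
          by (intro exI[of _ "(4 *\<^sub>R (p2 - p1), 0)"]) (auto simp: J_std_def zero_prod_def algebra_simps)
      qed
      then show False using reg[OF t01] t by blast
    qed
  qed
  moreover have "pathfinish ?\<gamma> = pathstart ?\<gamma>"
    using two_bounce_loop_pieces(1)[of 0 q1 q2 p1 p2] two_bounce_loop_pieces(4)[of 1 q1 q2 p1 p2]
    by (simp add: pathfinish_def pathstart_def)
  ultimately show ?thesis
    using defining_function_support_polar_set[OF S] fr two_bounce_loop_absolutely_continuous
    unfolding generalized_closed_characteristic_def path_image_def by blast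
qed

text \<open>Only the quarters on which \<open>q\<close> moves contribute, and there \<open>p\<close>
  is constant. Both contributions are positive as 0 is interior to \<open>T\<close>, so the absolute
  value disappears.\<close>

theorem action_two_bounce:
  fixes K T :: "'a::euclidean_space set"
  assumes tb: "two_bounce K T q1 q2 p1 p2" and T: "0 \<in> interior T"
  shows "action (two_bounce_loop q1 q2 p1 p2) = polygon_length T [q1, q2]"
proof -
  let ?\<gamma> = "two_bounce_loop q1 q2 p1 p2"
  let ?f = "\<lambda>t. snd (?\<gamma> t) \<bullet> fst (vector_derivative ?\<gamma> (at t))"
  have piece: "(?f has_integral (b - a) * c) {a..b}"
    if "a \<le> b" "\<And>t. t \<in> {a<..<b} \<Longrightarrow> ?f t = c" for a b c
  proof (rule has_integral_spike_finite[of "{a, b}"])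
    show "((\<lambda>_. c) has_integral (b - a) * c) {a..b}" using has_integral_const_real[of c a b] that(1) by simp
    show "?f t = c" if "t \<in> {a..b} - {a, b}" for t using \<open>\<And>t. t \<in> {a<..<b} \<Longrightarrow> ?f t = c\<close>[of t] that by auto
  qed simp
  note vd = two_bounce_loop_derivs[THEN vector_derivative_at]
  have 1: "(?f has_integral (1/4 - 0) * (4 * (p1 \<bullet> (q2 - q1)))) {0..1/4}"
    by (rule piece) (auto simp: two_bounce_loop_pieces(1) vd(1))
  have 2: "(?f has_integral (1/2 - 1/4) * 0) {1/4..1/2}"
    by (rule piece) (auto simp: vd(2))
  have 3: "(?f has_integral (3/4 - 1/2) * (4 * (p2 \<bullet> (q1 - q2)))) {1/2..3/4}"
    by (rule piece) (auto simp: two_bounce_loop_pieces(3) vd(3))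
  have 4: "(?f has_integral (1 - 3/4) * 0) {3/4..1}"
    by (rule piece) (auto simp: vd(4))
  note comb = has_integral_combine[where f = ?f]
  have "(?f has_integral p1 \<bullet> (q2 - q1) + p2 \<bullet> (q1 - q2)) {0..1}"
    using comb[OF _ _ comb[OF _ _ comb[OF _ _ 1 2] 3] 4] by simp
  moreover have "0 < p1 \<bullet> (q2 - q1)" "0 < p2 \<bullet> (q1 - q2)"
    using tb inner_normal_cone_interior_neg[OF T, of "q2 - q1" p1] inner_normal_cone_interior_neg[OF T, of "q1 - q2" p2]
    by (auto simp: two_bounce_def inner_commute)
  ultimately show ?thesis
    unfolding action_def polygon_length_2 support_function_two_bounce[OF tb]
    by (simp add: integral_unique)
qed

section \<open>The capacity\<close>

lemma inner_normal_cone_combination: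
  assumes "n1 \<in> normal_cone A x" "n2 \<in> normal_cone A x" "0 \<le> a" "0 \<le> b"
  shows "a *\<^sub>R n1 + b *\<^sub>R n2 \<in> normal_cone A x"
  using assms by (auto simp: normal_cone_def inner_add_left intro!: add_nonpos_nonpos mult_nonneg_nonpos)

lemma pentagon_normal_in_normal_cone:
  assumes "x \<bullet> pentagon_normal \<theta> k = cos (pi / 5)"
  shows "pentagon_normal \<theta> k \<in> normal_cone (pentagon \<theta>) x"
  using assms by (auto simp: normal_cone_def inner_diff_right mem_pentagon_iff_all inner_commute)

lemma inner_pentagon_vertex_facet:
  "pentagon_vertex \<theta> k \<bullet> pentagon_normal \<theta> k = cos (pi / 5)"
  "pentagon_vertex \<theta> (Suc k) \<bullet> pentagon_normal \<theta> k = cos (pi / 5)"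
proof -
  have "\<theta> + 2 * pi * real k / 5 - (\<theta> + pi / 5 + 2 * pi * real k / 5) = - (pi / 5)"
       "\<theta> + 2 * pi * real (Suc k) / 5 - (\<theta> + pi / 5 + 2 * pi * real k / 5) = pi / 5"
    by (simp_all add: field_simps)
  then show "pentagon_vertex \<theta> k \<bullet> pentagon_normal \<theta> k = cos (pi / 5)"
    "pentagon_vertex \<theta> (Suc k) \<bullet> pentagon_normal \<theta> k = cos (pi / 5)"
    unfolding pentagon_vertex_def pentagon_normal_def inner_polar by (simp_all only: cos_minus)
qed

text \<open>\<open>s\<close> is the angle from the normal \<open>k\<close> towards the normal
  \<open>Suc k\<close>; up to \<open>2 * pi / 5\<close> the direction is a nonnegative combination
  of these two.\<close>

lemma polar_in_normal_cone:
  assumes "0 \<le> s" "s \<le> 2 * pi / 5"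
  shows "polar (\<theta> + pi / 5 + 2 * pi * real k / 5 + s) \<in> normal_cone (pentagon \<theta>) (pentagon_vertex \<theta> (Suc k))"
proof -
  let ?S = "sin (2 * pi / 5)" and ?x = "polar (\<theta> + pi / 5 + 2 * pi * real k / 5 + s)"
  have k: "\<theta> + pi / 5 + 2 * pi * real (Suc k) / 5 = \<theta> + pi / 5 + 2 * pi * real k / 5 + 2 * pi / 5"
    by (simp add: field_simps)
  have "?S *\<^sub>R ?x = sin (2 * pi / 5 - s) *\<^sub>R pentagon_normal \<theta> k + sin s *\<^sub>R pentagon_normal \<theta> (Suc k)"
    using polar_interpolate[of "\<theta> + pi / 5 + 2 * pi * real k / 5 + 2 * pi / 5" "\<theta> + pi / 5 + 2 * pi * real k / 5" "\<theta> + pi / 5 + 2 * pi * real k / 5 + s"]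
    unfolding pentagon_normal_def k by (simp only: add_diff_cancel_left add_diff_cancel_left')
  also have "\<dots> \<in> normal_cone (pentagon \<theta>) (pentagon_vertex \<theta> (Suc k))"
    using assms by (intro inner_normal_cone_combination pentagon_normal_in_normal_cone inner_pentagon_vertex_facet sin_ge_zero) auto
  \<comment> \<open>The trivial second summand lets the lemma on combinations serve as closure under
    scaling.\<close>
  finally have "(1 / ?S) *\<^sub>R (?S *\<^sub>R ?x) + 0 *\<^sub>R 0 \<in> normal_cone (pentagon \<theta>) (pentagon_vertex \<theta> (Suc k))"
    using sin_2pi5_pos by (intro inner_normal_cone_combination) (auto simp: normal_cone_def)
  then show ?thesis using sin_2pi5_pos by simp
qed

text \<open>The diagonal joining the neighbours of vertex \<open>m\<close> is perpendicular to that
  vertex, and \<open>T_vert m\<close> is the same vertex after a quarter turn.\<close>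

lemma pentagon_diagonal:
  "pentagon_vertex 0 (m + 4) - pentagon_vertex 0 (m + 1) = (2 * sin (2 * pi / 5)) *\<^sub>R T_vert m"
  "pentagon_vertex 0 (m + 1) - pentagon_vertex 0 (m + 4) = (2 * sin (2 * pi / 5)) *\<^sub>R (- T_vert m)"
proof -
  have h: "((0 + 2 * pi * real (m + 4) / 5) - (0 + 2 * pi * real (m + 1) / 5)) / 2 = pi - 2 * pi / 5"
    "((0 + 2 * pi * real (m + 4) / 5) + (0 + 2 * pi * real (m + 1) / 5)) / 2 + pi / 2 = (- (pi / 2) + 2 * pi * real m / 5) + 2 * pi"
    by (simp_all add: field_simps)
  show diag: "pentagon_vertex 0 (m + 4) - pentagon_vertex 0 (m + 1) = (2 * sin (2 * pi / 5)) *\<^sub>R T_vert m"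
    unfolding pentagon_vertex_def polar_diff h polar_periodic sin_pi_minus ..
  show "pentagon_vertex 0 (m + 1) - pentagon_vertex 0 (m + 4) = (2 * sin (2 * pi / 5)) *\<^sub>R (- T_vert m)"
    unfolding scaleR_minus_right diag[symmetric] by simp
qed

text \<open>The second momentum is the foot of the altitude of \<open>T\<close> from
  \<open>T_vert m\<close>, the midpoint of the opposite side. The altitude is parallel to the
  diagonal, so all four conditions say that \<open>T_vert m\<close> or its negative is a
  normal.\<close>

lemma two_bounce_pentagons:
  "two_bounce K5 T5 (pentagon_vertex 0 (m + 1)) (pentagon_vertex 0 (m + 4)) (T_vert m) (- cos (pi / 5) *\<^sub>R T_vert m)"
proof -
  let ?c = "cos (pi / 5)" and ?s = "2 * sin (2 * pi / 5)"
  define a where "a = 2 * pi * real m / 5"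
  have tv: "T_vert m = polar (a - (pi / 2))" by (simp add: a_def pentagon_vertex_def)
  have minus_tv: "- T_vert m = polar (a + pi / 2)"
    unfolding tv polar_add_pi[symmetric] by (rule arg_cong[where f = polar]) simp
  have n2: "pentagon_normal (- (pi / 2)) (m + 2) = - T_vert m"
    unfolding minus_tv pentagon_normal_def by (rule arg_cong[where f = polar]) (simp add: a_def field_simps)
  note diag = pentagon_diagonal[of m]
  have norm_tv: "T_vert m \<bullet> T_vert m = 1" unfolding pentagon_vertex_def inner_polar by simp
  have abs1: "\<bar>pentagon_vertex s k \<bullet> pentagon_normal t l\<bar> \<le> 1" for s t k l unfolding pentagon_vertex_def pentagon_normal_def inner_polar by simp
  have tv0: "T_vert m \<noteq> 0" using norm_tv by force
  have c1: "0 < ?c" by (rule cos_pi5_pos)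
  have scale: "r *\<^sub>R u \<in> normal_cone A x" if "0 \<le> r" "u \<in> normal_cone A x" for r u x and A :: "(real^2) set"
    using that by (auto simp: normal_cone_def mult_nonneg_nonpos)
  have scale': "- (r *\<^sub>R u) \<in> normal_cone A x" if "0 \<le> r" "- u \<in> normal_cone A x" for r u x and A :: "(real^2) set"
    using scale[OF that] by simp
  have "T_vert m \<in> normal_cone T5 (T_vert m)"
    unfolding pentagon_def by (rule normal_cone_hullI) (auto simp: pentagon_vertex_def inner_polar)
  moreover have "- T_vert m \<in> normal_cone T5 (- ?c *\<^sub>R T_vert m)"
    using pentagon_normal_in_normal_cone[of "- ?c *\<^sub>R T_vert m" "- (pi / 2)" "m + 2"] norm_tv unfolding n2 by simp
  moreover have "- ?c *\<^sub>R T_vert m \<in> T5"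
    unfolding mem_pentagon_iff
  proof (intro allI impI)
    fix k :: nat
    have "- (T_vert m \<bullet> pentagon_normal (- (pi / 2)) k) \<le> 1" using abs1 by (simp add: abs_le_iff)
    then have "?c * (- (T_vert m \<bullet> pentagon_normal (- (pi / 2)) k)) \<le> ?c * 1"
      using c1 by (intro mult_left_mono) auto
    then show "(- ?c *\<^sub>R T_vert m) \<bullet> pentagon_normal (- (pi / 2)) k \<le> ?c" by simp
  qed
  moreover have "T_vert m \<in> normal_cone K5 (pentagon_vertex 0 (m + 4))"
  proof -
    \<comment> \<open>Measured from the first adjacent side normal, the direction stands at
      \<open>pi / 10\<close> here and at \<open>3 * pi / 10\<close> at the other end; both are
      within the opening \<open>2 * pi / 5\<close> of the cone.\<close>
    have "0 + pi / 5 + 2 * pi * real (m + 3) / 5 + pi / 10 = (a - (pi / 2)) + 2 * pi"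
      by (simp add: a_def field_simps)
    then have "T_vert m = polar (0 + pi / 5 + 2 * pi * real (m + 3) / 5 + pi / 10)"
      unfolding tv by (simp only: polar_periodic)
    moreover have "Suc (m + 3) = m + 4" by simp
    ultimately show ?thesis using polar_in_normal_cone[of "pi / 10" 0 "m + 3"] by (simp only:) simp
  qed
  moreover have "- T_vert m \<in> normal_cone K5 (pentagon_vertex 0 (m + 1))"
  proof -
    have "- T_vert m = polar (0 + pi / 5 + 2 * pi * real m / 5 + 3 * pi / 10)"
      unfolding minus_tv by (rule arg_cong[where f = polar]) (simp add: a_def)
    moreover have "Suc m = m + 1" by simp
    ultimately show ?thesis using polar_in_normal_cone[of "3 * pi / 10" 0 m] by (simp only:) simp
  qed
  moreover have "T_vert m - - ?c *\<^sub>R T_vert m = (1 + ?c) *\<^sub>R T_vert m" "- ?c *\<^sub>R T_vert m - T_vert m = (1 + ?c) *\<^sub>R (- T_vert m)"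
    by (simp_all add: algebra_simps)
  moreover have "pentagon_vertex 0 (m + 1) \<noteq> pentagon_vertex 0 (m + 4)" using diag(1) sin_2pi5_pos tv0 by fastforce
  moreover have "T_vert m \<noteq> - ?c *\<^sub>R T_vert m"
  proof
    assume "T_vert m = - ?c *\<^sub>R T_vert m"
    then have "T_vert m - - ?c *\<^sub>R T_vert m = 0" by simp
    then have "(1 + ?c) *\<^sub>R T_vert m = 0" by (simp add: algebra_simps)
    then show False using c1 tv0 by simp
  qed
  ultimately show ?thesis
    unfolding two_bounce_def diag using pentagon_vertex_in_pentagon sin_2pi5_pos c1 by (auto intro!: scale scale')
qed

text \<open>Along the diagonal direction \<open>T\<close> reaches 1 at the vertex and
  \<open>cos (pi / 5)\<close> at the opposite side; both are multiplied by the length of the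
  diagonal.\<close>

lemma diagonal_length:
  "polygon_length T5 [pentagon_vertex 0 (m + 1), pentagon_vertex 0 (m + 4)] = 2 * cos (pi / 10) * (1 + cos (pi / 5))"
proof -
  have "T_vert m \<bullet> T_vert m = 1" unfolding pentagon_vertex_def inner_polar by simp
  then show ?thesis
    unfolding polygon_length_2 support_function_two_bounce[OF two_bounce_pentagons]
    unfolding pentagon_diagonal cos_pi10
    by (simp add: algebra_simps)
qed

lemma polygon_length_commute: "polygon_length T [q2, q1] = polygon_length T [q1, q2]"
  by (simp add: polygon_length_2)

text \<open>Two non-adjacent vertices have a common neighbour \<open>m\<close>; the two cases are
  the orientations of the diagonal.\<close>

lemma nonadjacent_cases:
  assumes "i \<le> 4" "j \<le> 4" "i \<noteq> j" "j \<noteq> (i + 1) mod 5" "i \<noteq> (j + 1) mod 5"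
  obtains m where "i = (m + 1) mod 5" "j = (m + 4) mod 5" | m where "j = (m + 1) mod 5" "i = (m + 4) mod (5::nat)"
proof -
  have "i = 0 \<or> i = 1 \<or> i = 2 \<or> i = 3 \<or> i = 4" "j = 0 \<or> j = 1 \<or> j = 2 \<or> j = 3 \<or> j = 4"
    using assms(1,2) by auto
  then have "(\<exists>m. i = (m + 1) mod 5 \<and> j = (m + 4) mod 5) \<or> (\<exists>m. j = (m + 1) mod 5 \<and> i = (m + 4) mod 5)"
    using assms(3-5)
    by (elim disjE) (auto intro: exI[of _ 0] exI[of _ 1] exI[of _ 2] exI[of _ 3] exI[of _ 4])
  then show thesis using that by blast
qed

theorem proposition1p4:
  fixes i j :: nat
  assumes "i \<le> 4" and "j \<le> 4" and "i \<noteq> j"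
    and nonadjacent: "j \<noteq> (i + 1) mod 5" "i \<noteq> (j + 1) mod 5"
  shows "closed_billiard_trajectory pentagon_T pentagon_K [vertex_K i, vertex_K j] \<and>
    c_EHZ (pentagon_K \<times> pentagon_T) = polygon_length pentagon_T [vertex_K i, vertex_K j] \<and>
    polygon_length pentagon_T [vertex_K i, vertex_K j] =
      support_function pentagon_T (vertex_K j - vertex_K i) + support_function pentagon_T (vertex_K i - vertex_K j) \<and>
    support_function pentagon_T (vertex_K j - vertex_K i) + support_function pentagon_T (vertex_K i - vertex_K j) =
      2 * cos (pi / 10) * (1 + cos (pi / 5))"
proof -
  have vK: "vertex_K = pentagon_vertex 0" and vT: "vertex_T = pentagon_vertex (- (pi / 2))"
    by (simp_all add: fun_eq_iff vertex_K_def vertex_T_def polar_def pentagon_vertex_def)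
  have K: "pentagon_K = K5" and T: "pentagon_T = T5"
    by (simp_all only: pentagon_K_def pentagon_T_def pentagon_def vK vT)
  let ?C = "2 * cos (pi / 10) * (1 + cos (pi / 5))"
  \<comment> \<open>The momenta are left unspecified because reversing the diagonal exchanges
    them.\<close>
  obtain p1 p2 where tb: "two_bounce K5 T5 (pentagon_vertex 0 i) (pentagon_vertex 0 j) p1 p2"
    and len: "polygon_length T5 [pentagon_vertex 0 i, pentagon_vertex 0 j] = ?C"
  proof (cases rule: nonadjacent_cases[OF assms])
    case (1 m)
    then show thesis using that two_bounce_pentagons[of m] diagonal_length[of m] by (simp only: pentagon_vertex_mod_5)
  next
    case (2 m)
    then show thesis using that two_bounce_pentagons[of m, THEN two_bounce_commute] diagonal_length[of m]
      polygon_length_commute[of T5 "pentagon_vertex 0 (m + 4)"] by (simp only: pentagon_vertex_mod_5)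
  qed
  let ?\<gamma> = "two_bounce_loop (pentagon_vertex 0 i) (pentagon_vertex 0 j) p1 p2"
  have "c_EHZ (K5 \<times> T5) = ?C"
    unfolding c_EHZ_def
  \<comment> \<open>The loop over the diagonal attains the value, and the lower bound holds for
    every characteristic.\<close>
  proof (rule Least_equality)
    have "generalized_closed_characteristic (K5 \<times> T5) ?\<gamma>"
      by (intro generalized_closed_characteristic_two_bounce[OF tb] convex_pentagon closed_pentagon zero_in_interior_pentagon)
    moreover have "action ?\<gamma> = ?C" using action_two_bounce[OF tb zero_in_interior_pentagon] len by simp
    ultimately show "\<exists>\<gamma>. generalized_closed_characteristic (K5 \<times> T5) \<gamma> \<and> ?C = action \<gamma>" by metis
  qed (use action_lower_bound in blast)
  then show ?thesis
    using closed_billiard_trajectory_two_bounce[OF tb] len unfolding K T vK polygon_length_2 by simp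
qed

end
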